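(* Let $O(2)$ act on $\mathbb{R}^2$ by linear isometries (fixing the origin), with $2$ colors. Then $\mathrm{ext}_D(\mathbb{R}^2,O(2))=7$.
   Context: Let a group $\Gamma$ act faithfully on a set $X$. A coloring $c:X\to\{R,B\}$ is $\Gamma$-distinguishing if the only $\gamma\in\Gamma$ with $c\circ\gamma=c$ is the identity. For $W\subset X$ whose pointwise stabilizer in $\Gamma$ is trivial, the property $P(W)$ holds if every precoloring $c:X\setminus W\to\{R,B\}$ can be extended to a $\Gamma$-distinguishing coloring $X\to\{R,B\}$. The distinguishing extension number $\mathrm{ext}_D(X,\Gamma)$ is the smallest $m$ such that every $W\subset X$ with $|W|\geq m$ and trivial pointwise stabilizer satisfies $P(W)$ ($\infty$ if none exists). *)

theory Defs
  imports "HOL-Analysis.Analysis"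
begin

text \<open>A group \<Gamma> acting faithfully on a set X is represented by a set of
  maps X \<rightarrow> X (the action maps themselves). Two colours are represented by bool.\<close>

definition distinguishing :: "'a set \<Rightarrow> ('a \<Rightarrow> 'a) set \<Rightarrow> ('a \<Rightarrow> bool) \<Rightarrow> bool" where
  "distinguishing X \<Gamma> c \<longleftrightarrow>
     (\<forall>g\<in>\<Gamma>. (\<forall>x\<in>X. c (g x) = c x) \<longrightarrow> (\<forall>x\<in>X. g x = x))"

definition trivial_pointwise_stabilizer :: "'a set \<Rightarrow> ('a \<Rightarrow> 'a) set \<Rightarrow> 'a set \<Rightarrow> bool" where
  "trivial_pointwise_stabilizer X \<Gamma> W \<longleftrightarrow>
     (\<forall>g\<in>\<Gamma>. (\<forall>w\<in>W. g w = w) \<longrightarrow> (\<forall>x\<in>X. g x = x))"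

text \<open>Property P(W): every precolouring of X - W extends to a distinguishing colouring.
  A precolouring is given as a total function, only its values on X - W matter.\<close>
definition prop_P :: "'a set \<Rightarrow> ('a \<Rightarrow> 'a) set \<Rightarrow> 'a set \<Rightarrow> bool" where
  "prop_P X \<Gamma> W \<longleftrightarrow>
     (\<forall>c :: 'a \<Rightarrow> bool. \<exists>c'. (\<forall>x\<in>X - W. c' x = c x) \<and> distinguishing X \<Gamma> c')"

text \<open>|W| \<ge> m, with infinite sets having cardinality \<ge> every natural number.\<close>
definition card_at_least :: "'a set \<Rightarrow> nat \<Rightarrow> bool" where
  "card_at_least W m \<longleftrightarrow> infinite W \<or> m \<le> card W"

definition ext_good :: "'a set \<Rightarrow> ('a \<Rightarrow> 'a) set \<Rightarrow> nat \<Rightarrow> bool" where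
  "ext_good X \<Gamma> m \<longleftrightarrow>
     (\<forall>W. W \<subseteq> X \<and> card_at_least W m \<and> trivial_pointwise_stabilizer X \<Gamma> W
            \<longrightarrow> prop_P X \<Gamma> W)"

definition ext_D :: "'a set \<Rightarrow> ('a \<Rightarrow> 'a) set \<Rightarrow> enat" where
  "ext_D X \<Gamma> = (if \<exists>m. ext_good X \<Gamma> m then enat (LEAST m. ext_good X \<Gamma> m) else \<infinity>)"

definition O2 :: "(real^2 \<Rightarrow> real^2) set" where
  "O2 = {f. orthogonal_transformation f}"

end

theory Submission
  imports Defs
begin

text \<open>
  Property P passes to supersets. The lower bound comes from a regular pentagon together with the
  origin: every 2-colouring of the pentagon is invariant under one of its reflections.

  For the upper bound identify the plane with the complex numbers. Two colourings that differ in
  exactly one nonzero point cannot both have rotational symmetry. Hence two nonparallel points of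
  \<open>W\<close> on different circles already suffice, and otherwise six points of \<open>W\<close> lie on one circle.
  There the reflections are \<open>z \<mapsto> b / z\<close>, so the question is about the action of the dihedral
  extension of the multiplicative group on colourings that are free at six points.

  Assume that all 64 colourings are symmetric. If none of them is within Hamming distance one of
  a colouring with rotational symmetry, each has a unique reflection, and recolouring a point \<open>w\<close>
  off its axis yields a rotation \<open>a\<close> under which the colouring changes at exactly two points, one
  of them \<open>w\<close>. Such an \<open>a\<close> is unique up to inversion, so \<open>W\<close> consists of the two points on
  the axis and of four points determined by \<open>a\<close>; comparing this for two neighbouring colourings is
  contradictory. Otherwise the colourings are those obtained from a rotationally symmetric colouring
  by toggling a point \<open>x\<close> and a subset of \<open>W\<close>, and toggling a suitable scalene triangle through
  \<open>x\<close> destroys all symmetries; order two rotations need separate treatment.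
\<close>

section \<open>Colourings far from rotational symmetry\<close>

definition toggle :: "('a \<Rightarrow> bool) \<Rightarrow> 'a set \<Rightarrow> 'a \<Rightarrow> bool" where
  "toggle c Z z \<longleftrightarrow> c z \<noteq> (z \<in> Z)"

lemma toggle_empty [simp]: "toggle c {} = c"
  by (auto simp: toggle_def)

lemma toggle_toggle: "toggle (toggle c A) B = toggle c ((A - B) \<union> (B - A))"
  by (auto simp: toggle_def fun_eq_iff)

text \<open>Since \<open>b / 0 = 0\<close>, the junk value at the origin does not affect \<open>refl_inv\<close> below.\<close>

definition rot_inv :: "complex \<Rightarrow> (complex \<Rightarrow> bool) \<Rightarrow> bool" where
  "rot_inv a c \<longleftrightarrow> (\<forall>z. c (a * z) = c z)"

definition refl_inv :: "complex \<Rightarrow> (complex \<Rightarrow> bool) \<Rightarrow> bool" where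
  "refl_inv b c \<longleftrightarrow> (\<forall>z. c (b / z) = c z)"

definition asymmetric :: "(complex \<Rightarrow> bool) \<Rightarrow> bool" where
  "asymmetric c \<longleftrightarrow> (\<forall>a. a \<noteq> 0 \<longrightarrow> rot_inv a c \<longrightarrow> a = 1) \<and> (\<forall>b. b \<noteq> 0 \<longrightarrow> \<not> refl_inv b c)"

text \<open>The second conjunct keeps \<open>c\<close> away from rotational symmetry even after one
  recolouring, so defects that a single toggle would repair cannot occur.\<close>

definition rot_rigid :: "(complex \<Rightarrow> bool) \<Rightarrow> bool" where
  "rot_rigid c \<longleftrightarrow> (\<forall>a. a \<noteq> 0 \<longrightarrow> rot_inv a c \<longrightarrow> a = 1) \<and>
     (\<forall>a y. a \<noteq> 0 \<longrightarrow> y \<noteq> 0 \<longrightarrow> rot_inv a (toggle c {y}) \<longrightarrow> a = 1)"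

definition rot_defect :: "(complex \<Rightarrow> bool) \<Rightarrow> complex \<Rightarrow> complex \<Rightarrow> complex \<Rightarrow> bool" where
  "rot_defect c a w w' \<longleftrightarrow> a \<noteq> 0 \<and> a \<noteq> 1 \<and> w \<noteq> 0 \<and> w' \<noteq> 0 \<and> w \<noteq> w' \<and>
     (\<forall>z. c (a * z) \<longleftrightarrow> c z \<noteq> (z \<in> {w, w'}))"

lemma rot_rigidD:
  assumes "rot_rigid c" "a \<noteq> 0" "a \<noteq> 1"
  shows "\<not> rot_inv a c" "y \<noteq> 0 \<Longrightarrow> \<not> rot_inv a (toggle c {y})"
  using assms unfolding rot_rigid_def by blast+

lemma rot_defect_commute: "rot_defect c a w w' \<Longrightarrow> rot_defect c a w' w"
  unfolding rot_defect_def by (auto simp: insert_commute)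

lemma rot_defect_inverse:
  assumes "rot_defect c a w w'"
  shows "rot_defect c (1/a) (a*w) (a*w')"
proof -
  have a: "a \<noteq> 0" "a \<noteq> 1" and d: "\<And>z. c (a * z) \<longleftrightarrow> c z \<noteq> (z \<in> {w, w'})"
    using assms by (auto simp: rot_defect_def)
  have "c (1/a*z) \<longleftrightarrow> c z \<noteq> (z \<in> {a*w, a*w'})" for z
    using d[of "z/a"] a by (auto simp: field_simps)
  then show ?thesis
    using assms unfolding rot_defect_def by (auto simp: field_simps)
qed

text \<open>If the colour changes on entering \<open>a * w\<close> and again on leaving it, toggling
  this single point repairs both defects, which rigidity forbids.\<close>

lemma rot_defect_not_adjacent:
  assumes "rot_rigid c" "rot_defect c a w w'"
  shows "w' \<noteq> a * w"
proof
  assume w': "w' = a * w"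
  have a: "a \<noteq> 0" "a \<noteq> 1" "w' \<noteq> 0" and d: "\<And>z. c (a * z) \<longleftrightarrow> c z \<noteq> (z \<in> {w, w'})"
    using assms(2) by (auto simp: rot_defect_def)
  have "rot_inv a (toggle c {w'})"
    unfolding rot_inv_def toggle_def using a by (auto simp: d w')
  then show False using assms(1) a by (auto simp: rot_rigid_def)
qed

lemma rot_defect_not_neg:
  assumes "rot_rigid c" "rot_defect c a w w'"
  shows "a \<noteq> -1"
proof
  assume a: "a = -1"
  have d: "\<And>z. c (- z) \<longleftrightarrow> c z \<noteq> (z \<in> {w, w'})" and n: "w \<noteq> 0"
    using assms(2) by (auto simp: rot_defect_def a)
  have "-w \<in> {w,w'}" using d[of w] d[of "-w"] by auto
  then show False using rot_defect_not_adjacent[OF assms] n by (auto simp: a)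
qed

text \<open>The two rotations differ by the antipodal map, so comparing them shows where
  \<open>c\<close> fails to be antipodally symmetric. By rigidity this failure must involve four
  points, and the position of the two pairs then determines \<open>a\<^sup>2\<close>.\<close>

lemma rot_defect_neg:
  assumes R: "rot_rigid c" and d1: "rot_defect c a w w'" and d2: "rot_defect c (-a) v v'"
  shows "a\<^sup>2 = -1"
proof -
  have a: "a \<noteq> 0" "a \<noteq> 1" "a \<noteq> -1" and n: "w \<noteq> 0" "w' \<noteq> 0" "v \<noteq> 0" "v' \<noteq> 0" "w \<noteq> w'" "v \<noteq> v'"
    and c1: "\<And>z. c (a * z) \<longleftrightarrow> c z \<noteq> (z \<in> {w, w'})"
    and c2: "\<And>z. c (- a * z) \<longleftrightarrow> c z \<noteq> (z \<in> {v, v'})"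
    using d1 d2 rot_defect_not_neg[OF R d1] by (auto simp: rot_defect_def)
  \<comment> \<open>\<open>c\<close> and its antipodal image differ exactly on
    \<open>a * T\<close>.\<close>
  define T where "T z \<longleftrightarrow> (z \<in> {w,w'}) \<noteq> (z \<in> {v,v'})" for z
  have cT: "c (- (a * z)) \<longleftrightarrow> c (a * z) \<noteq> T z" for z
    using c1[of z] c2[of z] by (auto simp: T_def)
  have cT': "c (- z) \<longleftrightarrow> c z \<noteq> T (z / a)" for z
    using cT[of "z/a"] a by simp
  have Tneg: "T (-z) = T z" for z
    using cT[of z] cT[of "-z"] by auto
  \<comment> \<open>A single antipodal pair of defects disappears when one of its points is
    toggled.\<close>
  have no_pair: False if "\<And>z. T z \<longleftrightarrow> z = t \<or> z = -t" "t \<noteq> 0" for t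
  proof -
    have "z / a = -t \<longleftrightarrow> -z = a*t" "z / a = t \<longleftrightarrow> z = a*t" for z
      using a by (auto simp: divide_eq_eq mult.commute) (metis minus_minus)
    then have "T (z / a) \<longleftrightarrow> z = a*t \<or> -z = a*t" for z
      unfolding that(1) by auto
    then have "rot_inv (-1) (toggle c {a*t})"
      unfolding rot_inv_def toggle_def using a that(2) by (auto simp: cT')
    then show False using rot_rigidD(2)[OF R, of "-1" "a*t"] a that by auto
  qed
  have disj: "{w,w'} \<inter> {v,v'} = {}"
  proof (rule ccontr)
    assume "{w,w'} \<inter> {v,v'} \<noteq> {}"
    then obtain p q s where p: "{w,w'} = {s,p}" "{v,v'} = {s,q}" "p \<noteq> s" "q \<noteq> s" "p \<noteq> 0" "q \<noteq> 0"
      using n by (auto simp: doubleton_eq_iff)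
    have T: "T z \<longleftrightarrow> (z = p) \<noteq> (z = q)" for z
      unfolding T_def p using p by auto
    show False
    proof (cases "p = q")
      case True
      then have "rot_inv (-1) c" unfolding rot_inv_def by (auto simp: cT' T)
      then show False using rot_rigidD(1)[OF R, of "-1"] by auto
    next
      case False
      then have "q = -p" using Tneg[of p] T p by auto
      moreover have "p \<noteq> -p" using p by simp
      ultimately have "T z \<longleftrightarrow> z = p \<or> z = -p" for z using T[of z] by auto
      then show False using no_pair[of p] p by blast
    qed
  qed
  \<comment> \<open>The colour at \<open>- a * a * z\<close> is computed in two ways, applying
    \<open>a\<close> and \<open>-a\<close> in either order.\<close>
  have comm: "(z \<in> {w,w'}) \<noteq> (-a*z \<in> {w,w'}) \<longleftrightarrow> (z \<in> {v,v'}) \<noteq> (a*z \<in> {v,v'})" for z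
    using c1[of z] c2[of z] c1[of "-a*z"] c2[of "a*z"] by (auto simp: algebra_simps)
  have T: "T z \<longleftrightarrow> z \<in> {w,w',v,v'}" for z using disj by (auto simp: T_def)
  have "-w \<in> {w',v,v'}" "-w' \<in> {w,v,v'}" "-v \<in> {w,w',v'}" "-v' \<in> {w,w',v}"
    using Tneg[of w] Tneg[of w'] Tneg[of v] Tneg[of v'] n by (auto simp: T)
  then consider "w' = -w" "v' = -v" | "{v,v'} = {-w,-w'}"
  proof -
    consider "-w = w'" | "-w = v" | "-w = v'" using \<open>-w \<in> {w',v,v'}\<close> by auto
    then show ?thesis
    proof cases
      case 1
      then have "-v \<noteq> w" "-v \<noteq> w'" using disj by auto
      then show ?thesis using \<open>-v \<in> {w,w',v'}\<close> 1 that(1) by auto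
    next
      case 2
      then have "-w' \<noteq> w" "-w' \<noteq> v" using disj n by auto
      then show ?thesis using \<open>-w' \<in> {w,v,v'}\<close> 2 that(2) by auto
    next
      case 3
      then have "-w' \<noteq> w" "-w' \<noteq> v'" using disj n by auto
      then show ?thesis using \<open>-w' \<in> {w,v,v'}\<close> 3 that(2) by auto
    qed
  qed
  then show ?thesis
  proof cases
    case 1
    have neg_mult: "a * t \<noteq> - t" if "t \<noteq> 0" for t
      using a(3) that by (metis mult_cancel_right mult_minus1)
    have "-(a * w) \<noteq> w" using neg_mult[OF n(1)] by (metis minus_minus)
    have "w \<noteq> v" "w \<noteq> -v" using disj 1 by auto
    then have "a * w = v \<or> a * w = -v"
      using comm[of w] a n \<open>-(a * w) \<noteq> w\<close> by (auto simp: 1)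
    moreover have "a * v = w \<or> a * v = -w"
    proof -
      have "v \<noteq> w" "v \<noteq> -w" using disj 1 by auto
      then have "-a * v = w \<or> -a * v = -w" using comm[of v] a n neg_mult[OF n(3)] by (auto simp: 1)
      then show ?thesis by auto
    qed
    ultimately have "a * (a * w) = w \<or> a * (a * w) = -w" by (metis mult_minus_right minus_minus)
    then have "(a - 1) * (a + 1) * w = 0 \<or> (a\<^sup>2 + 1) * w = 0"
      by (auto simp: algebra_simps power2_eq_square)
    then show ?thesis using n a by (auto simp: add_eq_0_iff2)
  next
    case 2
    have "-y = w \<longleftrightarrow> y = -w" for y w :: complex by auto
    with 2 have "-a*z \<in> {w,w'} \<longleftrightarrow> a*z \<in> {v,v'}" for z by simp
    then have "z \<in> {w,w'} \<longleftrightarrow> z \<in> {v,v'}" for z using comm[of z] by auto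
    then show ?thesis using disj by blast
  qed
qed

text \<open>The changes of \<open>c\<close> under \<open>a\<close>, followed by those under \<open>a'\<close>, can be computed in either order.\<close>

lemma rot_defect_squares:
  assumes R: "rot_rigid c" and d1: "rot_defect c a w w'" and d2: "rot_defect c a' v v'"
  shows "a'\<^sup>2 = a\<^sup>2 \<or> (a * a')\<^sup>2 = 1"
proof (rule ccontr)
  assume "\<not> ?thesis"
  then have neg: "\<not> ?thesis" "a' \<noteq> a" "a * a' \<noteq> 1" by auto
  have a: "a \<noteq> 0" "a \<noteq> 1" "a \<noteq> -1" "a' \<noteq> 0" "a' \<noteq> 1" "a' \<noteq> -1"
    and n: "w \<noteq> 0" "w' \<noteq> 0" "v \<noteq> 0" "v' \<noteq> 0" "w \<noteq> w'" "v \<noteq> v'"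
    and c1: "\<And>z. c (a * z) \<longleftrightarrow> c z \<noteq> (z \<in> {w, w'})"
    and c2: "\<And>z. c (a' * z) \<longleftrightarrow> c z \<noteq> (z \<in> {v, v'})"
    using d1 d2 rot_defect_not_neg[OF R d1] rot_defect_not_neg[OF R d2] by (auto simp: rot_defect_def)
  have sq: "a * a \<noteq> 1" "a' * a' \<noteq> 1" 
    using a by (auto simp: square_eq_1_iff)
  have adj: "w' \<noteq> a * w" "w \<noteq> a * w'" "v' \<noteq> a' * v" "v \<noteq> a' * v'"
    using rot_defect_not_adjacent[OF R] d1 d2 rot_defect_commute by blast+
  define L where "L = {z. (z \<in> {w,w'}) \<noteq> (a'*z \<in> {w,w'})}"
  define M where "M = {z. (z \<in> {v,v'}) \<noteq> (a*z \<in> {v,v'})}"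
  have "z \<in> L \<longleftrightarrow> z \<in> M" for z
    unfolding L_def M_def using c1[of z] c2[of z] c1[of "a'*z"] c2[of "a*z"] mult.left_commute[of a a' z]
    by auto
  then have LM: "L = M" by blast
  \<comment> \<open>If \<open>q = s * p\<close>, the pair and its preimage under \<open>s\<close>
    share \<open>p\<close>, which leaves two points. Otherwise, as shown next, they are disjoint and
    leave four. Comparing cardinalities of \<open>L\<close> and \<open>M\<close> then matches the
    two cases.\<close>
  have *: "{z. (z \<in> {p,q}) \<noteq> (s*z \<in> {p,q})} = {s*p, p/s}"
    if "q = s * p" "s \<noteq> 0" "s * s \<noteq> 1" "p \<noteq> 0" "p \<noteq> q" for p q s :: complex
    using that by (auto simp: field_simps)
  have **: "{z. (z \<in> {p,q}) \<noteq> (s*z \<in> {p,q})} = {p, q, p/s, q/s} \<and> card {p, q, p/s, q/s} = 4"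
    if "q \<noteq> s * p" "p \<noteq> s * q" "s \<noteq> 0" "s \<noteq> 1" "p \<noteq> 0" "q \<noteq> 0" "p \<noteq> q" for p q s :: complex
  proof -
    have "distinct [p, q, p/s, q/s]" using that by (auto simp: field_simps)
    then have "card {p, q, p/s, q/s} = 4" using distinct_card[of "[p, q, p/s, q/s]"] by simp
    then show ?thesis using that by (auto simp: field_simps)
  qed
  have L: "(\<exists>t. t \<noteq> 0 \<and> L = {a'*t, t/a'}) \<or> L = {w, w', w/a', w'/a'} \<and> card L = 4"
  proof (cases "w' = a' * w \<or> w = a' * w'")
    case True
    then show ?thesis
    proof
      assume "w' = a' * w"
      then have "L = {a'*w, w/a'}" unfolding L_def using a n sq by (intro *) auto
      then show ?thesis using n by blast
    next
      assume "w = a' * w'"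
      then have "{z. (z \<in> {w', w}) \<noteq> (a' * z \<in> {w', w})} = {a'*w', w'/a'}"
        using a n sq by (intro *) auto
      then have "L = {a'*w', w'/a'}" unfolding L_def insert_commute[of w w'] .
      then show ?thesis using n by blast
    qed
  next
    case False
    then show ?thesis using **[of w' a' w] a n unfolding L_def by auto
  qed
  have M: "(\<exists>t. t \<noteq> 0 \<and> M = {a*t, t/a}) \<or> M = {v, v', v/a, v'/a} \<and> card M = 4"
  proof (cases "v' = a * v \<or> v = a * v'")
    case True
    then show ?thesis
    proof
      assume "v' = a * v"
      then have "M = {a * v, v/a}" unfolding M_def using a n sq by (intro *) auto
      then show ?thesis using n by blast
    next
      assume "v = a * v'"
      then have "{z. (z \<in> {v', v}) \<noteq> (a * z \<in> {v', v})} = {a * v', v'/a}"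
        using a n sq by (intro *) auto
      then have "M = {a * v', v'/a}" unfolding M_def insert_commute[of v v'] .
      then show ?thesis using n by blast
    qed
  next
    case False
    then show ?thesis using **[of v' a v] a n unfolding M_def by auto
  qed
  have small: "card {p, q} \<noteq> 4" for p q :: complex
    by (cases "p = q") auto
  from L M consider t s where "t \<noteq> 0" "s \<noteq> 0" "{a'*t, t/a'} = {a * s, s/a}"
    | "L = {w, w', w/a', w'/a'}" "M = {v, v', v/a, v'/a}"
    using LM small by metis
  then show False
  proof cases
    case (1 t s)
    then have "a' * t = a * s \<and> t * a = s * a' \<or> a' * t * a = s \<and> t = a * s * a'"
      using a by (auto simp: doubleton_eq_iff field_simps)
    then have "(a'\<^sup>2 - a\<^sup>2) * t = 0 \<or> ((a * a')\<^sup>2 - 1) * t = 0"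
      using a by algebra
    then show False using 1 neg by auto
  next
    case 2
    have eq: "{w, w', w/a', w'/a'} = {v, v', v/a, v'/a}" using 2 LM by metis
    \<comment> \<open>The set \<open>M\<close> is a union of pairs \<open>{v, v/a}\<close>, so with
      each element it contains its image under \<open>a\<close> or under \<open>1/a\<close>. Since
      it equals \<open>L\<close>, the points \<open>w\<close> and \<open>w'\<close> have such
      partners in \<open>L\<close>.\<close>
    have cl: "a*z \<in> {w, w', w/a', w'/a'} \<or> z/a \<in> {w, w', w/a', w'/a'}" if "z \<in> {w,w'}" for z
    proof -
      have "z \<in> {w, w', w/a', w'/a'}" using that by blast
      then show ?thesis unfolding eq using a by auto
    qed
    have "w' = a*a'*w \<or> a*w' = a'*w"
      using cl[of w] a n adj neg by (auto simp: field_simps)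
    moreover have "w = a*a'*w' \<or> a*w = a'*w'"
      using cl[of w'] a n adj neg by (auto simp: field_simps)
    ultimately have "((a * a')\<^sup>2 - 1) * w = 0 \<or> (a'\<^sup>2 - a\<^sup>2) * w = 0 \<or> (a'*a'-1) * a * w = 0 "
      by algebra
    then show False using n neg sq a by auto
  qed
qed

text \<open>The relation between the squares determines \<open>a'\<close> up to inversion and sign.
  A wrong sign forces \<open>a\<^sup>2 = -1\<close>, and then \<open>- a = 1/a\<close>.\<close>

lemma rot_defect_unique:
  assumes R: "rot_rigid c" and d1: "rot_defect c a w w'" and d2: "rot_defect c a' v v'"
  shows "a' = a \<or> a' = 1/a"
proof -
  have a: "a \<noteq> 0" "a' \<noteq> 0" using d1 d2 by (auto simp: rot_defect_def)
  consider "a' = a" | "a' = 1/a" | "a' = -a" | "1/a' = -a"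
  proof -
    have "(a' - a) * (a' + a) = 0 \<or> (a*a' - 1) * (a*a' + 1) = 0"
      using rot_defect_squares[OF assms] by (auto simp: algebra_simps power2_eq_square)
    then have "a' = a \<or> a' = -a \<or> a*a' = 1 \<or> a*a' = -1" by (auto simp: add_eq_0_iff2)
    then have "a' = a \<or> a' = 1/a \<or> a' = -a \<or> 1/a' = -a" using a by (auto simp: field_simps)
    then show ?thesis using that by blast
  qed
  then show ?thesis
  proof cases
    case 3
    then have "a\<^sup>2 = -1" using rot_defect_neg[OF R d1] d2 by simp
    then show ?thesis using a 3 by (auto simp: field_simps power2_eq_square)
  next
    case 4
    then have "a\<^sup>2 = -1" using rot_defect_neg[OF R d1] rot_defect_inverse[OF d2] by simp
    moreover have "a' * a = -1" using a 4 by (metis minus_minus mult_minus_right nonzero_divide_eq_eq mult.commute)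
    ultimately have "a' * a = a * a" by (simp add: power2_eq_square)
    then have "a' = a" using a by simp
    then show ?thesis ..
  qed auto
qed

section \<open>Six points around a rigid colouring\<close>

text \<open>The composition of the two reflections is multiplication by \<open>b/b'\<close>. The
  recolouring of \<open>w\<close> is felt at \<open>w\<close> and at its mirror image
  \<open>b'/w\<close>; if these coincided, the rotation would preserve \<open>c\<close>.\<close>

lemma rot_defect_of_refl:
  assumes R: "rot_rigid c" and b: "b \<noteq> 0" "refl_inv b c" and w: "w \<noteq> 0" "w * w \<noteq> b"
    and b': "b' \<noteq> 0" "refl_inv b' (toggle c {w})"
  shows "rot_defect c (b/b') w (b'/w)"
proof -
  have c: "c (b/z) = c z" and c': "(c (b'/z) \<noteq> (b'/z = w)) = (c z \<noteq> (z = w))" for z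
    using b b' by (auto simp: refl_inv_def toggle_def)
  have "b' \<noteq> b"
  proof
    assume "b' = b"
    then have "b / w = w" using c[of w] c'[of w] by auto
    then show False using w by (auto simp: field_simps)
  qed
  have d: "c (b/b' * z) \<longleftrightarrow> (c z \<noteq> (z = w)) \<noteq> (z = b'/w)" for z
  proof (cases "z = 0")
    case False
    then have "b'/z = w \<longleftrightarrow> z = b'/w" using w by (auto simp: field_simps)
    then show ?thesis using c[of "b'/z"] c'[of z] by auto
  qed (use w b' in auto)
  have "w \<noteq> b'/w"
  proof
    assume "w = b'/w"
    then have "rot_inv (b/b') c" using d by (auto simp: rot_inv_def)
    then show False using rot_rigidD(1)[OF R, of "b/b'"] b b' \<open>b' \<noteq> b\<close> by auto
  qed
  then have "c (b/b' * z) \<longleftrightarrow> c z \<noteq> (z \<in> {w, b'/w})" for z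
  proof -
    have "(P \<noteq> (z = w)) \<noteq> (z = u) \<longleftrightarrow> P \<noteq> (z \<in> {w, u})" if "w \<noteq> u" for P u using that by auto
    then show ?thesis using d[of z] \<open>w \<noteq> b'/w\<close> by metis
  qed
  moreover have "b/b' \<noteq> 0" "b/b' \<noteq> 1" "b'/w \<noteq> 0" using b b' w \<open>b' \<noteq> b\<close> by auto
  ultimately show ?thesis
    unfolding rot_defect_def using w \<open>w \<noteq> b'/w\<close> by blast
qed

lemma rot_defect_support:
  assumes "rot_defect c a u u'" "rot_defect c a v v'"
  shows "v \<in> {u, u'}"
proof -
  have "c (a * v) \<longleftrightarrow> c v \<noteq> (v \<in> {u, u'})" "c (a * v) \<longleftrightarrow> c v \<noteq> (v \<in> {v, v'})"
    using assms unfolding rot_defect_def by blast+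
  then show ?thesis by auto
qed

text \<open>A point of \<open>W\<close> on the axis is a fixed point
  \<open>\<plusminus> csqrt b\<close> of the reflection. Any other point lies in a defect pair,
  whose multiplier is \<open>a\<close> or \<open>1/a\<close> by uniqueness. These possibilities give
  only six candidates, so \<open>W\<close> exhausts them without repetition.\<close>

lemma rigid_six_points:
  assumes R: "rot_rigid c" and b: "b \<noteq> 0" "refl_inv b c" and W: "card W = 6" "0 \<notin> W"
    and nb: "\<And>w. w \<in> W \<Longrightarrow> \<exists>b'. b' \<noteq> 0 \<and> refl_inv b' (toggle c {w})"
    and d: "rot_defect c a u u'"
  shows "W = set [csqrt b, - csqrt b, u, u', a*u, a*u'] \<and>
    distinct [csqrt b, - csqrt b, u, u', a*u, a*u']"
proof -
  let ?l = "[csqrt b, - csqrt b, u, u', a*u, a*u']"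
  have "w \<in> set ?l" if w: "w \<in> W" for w
  proof (cases "w * w = b")
    case True
    then have "w^2 = (csqrt b)^2" by (simp add: power2_eq_square[of w])
    then have "w = csqrt b \<or> w = - csqrt b" by (simp only: power2_eq_iff)
    then show ?thesis by auto
  next
    case False
    obtain b' where b': "b' \<noteq> 0" "refl_inv b' (toggle c {w})" using nb[OF w] by blast
    have "w \<noteq> 0" using w W by auto
    note d' = rot_defect_of_refl[OF R b this False b']
    from rot_defect_unique[OF R d d'] show ?thesis
    proof
      assume "b/b' = a"
      then show ?thesis using rot_defect_support[OF d] d' by auto
    next
      assume "b/b' = 1/a"
      then show ?thesis using rot_defect_support[OF rot_defect_inverse[OF d]] d' by auto
    qed
  qed
  then have "W \<subseteq> set ?l" by blast
  moreover have "card (set ?l) \<le> 6" using card_length[of ?l] by simp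
  ultimately have "W = set ?l" using W card_seteq[of "set ?l" W] by simp
  moreover from this have "distinct ?l" using W by (intro card_distinct) simp
  ultimately show ?thesis by blast
qed

lemma asymmetric_if_rigid:
  assumes W: "card W = 6" "0 \<notin> W" and R: "\<And>S. S \<subseteq> W \<Longrightarrow> rot_rigid (toggle c S)"
  shows "\<exists>S\<subseteq>W. asymmetric (toggle c S)"
proof (rule ccontr)
  assume neg: "\<not> ?thesis"
  have sym: "\<exists>b. b \<noteq> 0 \<and> refl_inv b (toggle c S)" if "S \<subseteq> W" for S
  proof -
    have "\<not> asymmetric (toggle c S)" using neg that by blast
    moreover have "a = 1" if "a \<noteq> 0" "rot_inv a (toggle c S)" for a
      using rot_rigidD(1)[OF R[OF \<open>S \<subseteq> W\<close>]] that by blast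
    ultimately show ?thesis unfolding asymmetric_def by metis
  qed
  have Rc: "rot_rigid c" using R[of "{}"] by simp
  obtain b where b: "b \<noteq> 0" "refl_inv b c" using sym[of "{}"] by auto
  have "\<not> W \<subseteq> {csqrt b, - csqrt b}"
    using card_mono[of "{csqrt b, - csqrt b}" W] W card_length[of "[csqrt b, - csqrt b]"] by auto
  then obtain w where w: "w \<in> W" "w \<noteq> csqrt b" "w \<noteq> - csqrt b" by auto
  then have "w^2 \<noteq> (csqrt b)^2" by (metis power2_eq_iff)
  then have w2: "w * w \<noteq> b" by (simp add: power2_eq_square[of w])
  have w0: "w \<noteq> 0" using w W by auto
  obtain b' where b': "b' \<noteq> 0" "refl_inv b' (toggle c {w})" using sym[of "{w}"] w by auto
  define a where "a = b / b'"
  define u where "u = b' / w"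
  have d: "rot_defect c a w u"
    unfolding a_def u_def by (rule rot_defect_of_refl[OF Rc b w0 w2 b'])
  then have a: "a \<noteq> 0" "a \<noteq> 1" "u \<noteq> 0" "w \<noteq> u" and da: "\<And>z. c (a * z) \<longleftrightarrow> c z \<noteq> (z \<in> {w,u})"
    by (auto simp: rot_defect_def)
  have one: "W = set [csqrt b, - csqrt b, w, u, a*w, a*u]" "distinct [csqrt b, - csqrt b, w, u, a*w, a*u]"
    using rigid_six_points[OF Rc b W _ d] sym by auto
  have R': "rot_rigid (toggle c {w})" using R w by simp
  have "w \<noteq> a * u" using one by auto
  then have ne: "u \<noteq> w/a" using a by (auto simp: field_simps)
  have "toggle c {w} (a*z) \<longleftrightarrow> toggle c {w} z \<noteq> (z \<in> {u, w/a})" for z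
  proof -
    have "a * z = w \<longleftrightarrow> z = w/a" using a by (auto simp: field_simps)
    moreover have "w \<noteq> w/a" using a w0 by (auto simp: field_simps)
    ultimately show ?thesis using da[of z] ne a by (auto simp: toggle_def)
  qed
  \<comment> \<open>Toggling \<open>w\<close> moves its defect under \<open>a\<close> one step back,
    to \<open>w/a\<close>, and leaves the one at \<open>u\<close>.\<close>
  then have d': "rot_defect (toggle c {w}) a u (w/a)"
    unfolding rot_defect_def using a w0 ne by auto
  have "\<exists>b'. b' \<noteq> 0 \<and> refl_inv b' (toggle (toggle c {w}) {v})" if "v \<in> W" for v
    unfolding toggle_toggle using that w by (intro sym) auto
  from rigid_six_points[OF R' b' W this d'] a(1)
  have two: "W = {csqrt b', - csqrt b', u, w/a, a*u, w}" by simp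
  have "b \<noteq> b'" using a(2) b' by (auto simp: a_def)
  then have "(csqrt b)^2 \<noteq> (csqrt b')^2" by simp
  then have ne2: "csqrt b \<noteq> csqrt b'" "csqrt b \<noteq> - csqrt b'" "- csqrt b \<noteq> csqrt b'"
    by (metis power2_minus)+
  \<comment> \<open>The two descriptions of \<open>W\<close> have the points \<open>u\<close>,
    \<open>a*u\<close> and \<open>w\<close> in common. The axis points
    \<open>\<plusminus> csqrt b\<close> are none of these and differ from
    \<open>\<plusminus> csqrt b'\<close>, so both would have to be \<open>w/a\<close>.\<close>
  have "csqrt b \<in> W" "- csqrt b \<in> W" using one by auto
  then have "csqrt b = w/a" "- csqrt b = w/a" using ne2 one(2) unfolding two by auto
  then show False using one(2) by auto
qed

section \<open>Scalene triangles\<close>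

text \<open>Since \<open>a / 0 = 0\<close>, all these maps fix the origin and are injective on the
  whole plane.\<close>

definition circle_map :: "(complex \<Rightarrow> complex) \<Rightarrow> bool" where
  "circle_map g \<longleftrightarrow> (\<exists>a. a \<noteq> 0 \<and> (g = (\<lambda>z. a * z) \<or> g = (\<lambda>z. a / z)))"

lemma circle_mapI:
  "a \<noteq> 0 \<Longrightarrow> circle_map (\<lambda>z. a * z)" "a \<noteq> 0 \<Longrightarrow> circle_map (\<lambda>z. a / z)"
  unfolding circle_map_def by blast+

lemma not_asymmetricE:
  assumes "\<not> asymmetric c"
  obtains g where "circle_map g" "g \<noteq> id" "\<And>z. c (g z) = c z"
proof -
  from assms consider a where "a \<noteq> 0" "a \<noteq> 1" "rot_inv a c" | b where "b \<noteq> 0" "refl_inv b c"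
    unfolding asymmetric_def by blast
  then show ?thesis
  proof cases
    case 1
    have "(\<lambda>z. a * z) \<noteq> id" using 1 by (auto simp: fun_eq_iff dest: spec[of _ 1])
    then show ?thesis using 1 that[of "\<lambda>z. a * z"] unfolding circle_map_def rot_inv_def by blast
  next
    case 2
    have "(\<lambda>z. b / z) \<noteq> id"
    proof
      assume "(\<lambda>z. b / z) = id"
      then have "b / 1 = 1" "b / 2 = 2" by (metis id_apply)+
      then show False by simp
    qed
    then show ?thesis using 2 that[of "\<lambda>z. b / z"] unfolding circle_map_def refl_inv_def by blast
  qed
qed

lemma circle_map_inj: "circle_map g \<Longrightarrow> g y = g z \<longleftrightarrow> y = z"
  unfolding circle_map_def by auto

lemma circle_map_minus: "circle_map g \<Longrightarrow> g (- z) = - g z"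
  unfolding circle_map_def by auto

text \<open>Moving \<open>h\<close> past \<open>g\<close> turns multiplication by \<open>h\<close>
  into multiplication by \<open>h\<close> or by its inverse, and \<open>c\<close> is invariant under
  both.\<close>

lemma circle_map_rot_inv:
  assumes "circle_map g" "rot_inv h c" "h \<noteq> 0"
  shows "c (g (h * z)) = c (g z)"
proof -
  have r: "c (h * y) = c y" for y using assms by (auto simp: rot_inv_def)
  have r': "c (y / h) = c y" for y using r[of "y/h"] assms by simp
  obtain a where "g = (\<lambda>z. a * z) \<or> g = (\<lambda>z. a / z)"
    using assms(1) unfolding circle_map_def by blast
  moreover have "a * (h * z) = h * (a * z)" "a / (h * z) = a / z / h" by simp_all
  ultimately show ?thesis using r[of "a * z"] r'[of "a / z"] by metis
qed

text \<open>The equation \<open>p * q = r * r\<close> says that the reflection exchanging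
  \<open>p\<close> and \<open>q\<close> fixes \<open>r\<close>, so that the triangle is isosceles
  with apex \<open>r\<close>. This is excluded at each of the three vertices.\<close>

definition scalene :: "complex \<Rightarrow> complex \<Rightarrow> complex \<Rightarrow> bool" where
  "scalene x u v \<longleftrightarrow> u * v \<noteq> x * x \<and> u * u \<noteq> x * v \<and> v * v \<noteq> x * u"

text \<open>A nontrivial rotation of the triangle would either permute the vertices cyclically or be
  \<open>-1\<close> and carry the third vertex outside. A reflection exchanging two vertices would
  fix the third one.\<close>

lemma scalene_rigid:
  assumes g: "circle_map g" and n: "x \<noteq> 0" "u \<noteq> 0" "v \<noteq> 0" "x \<noteq> u" "x \<noteq> v" "u \<noteq> v"
    and s: "scalene x u v" and gx: "g x \<in> {x,u,v}" and gu: "g u \<in> {x,u,v}" and gv: "g v \<in> {x,u,v}"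
  shows "g = id"
proof -
  obtain a where a: "a \<noteq> 0" "g = (\<lambda>z. a * z) \<or> g = (\<lambda>z. a / z)"
    using g unfolding circle_map_def by blast
  from a(2) show ?thesis
  proof
    assume g': "g = (\<lambda>z. a * z)"
    consider "a * x = x" | "a * x = u" | "a * x = v" using gx g' by auto
    then show ?thesis
    proof cases
      case 1
      then show ?thesis using n g' by auto
    next
      case 2
      then have "a * u = x" using gu n s unfolding scalene_def g' by auto
      then have "a * a * x = x" using 2 by (simp add: mult.assoc)
      then have "a * a = 1" using n by simp
      then have "a = -1" using 2 n by (auto simp: square_eq_1_iff)
      then show ?thesis using gv n 2 unfolding g' by auto
    next
      case 3
      then have "a * v = x" using gv n s unfolding scalene_def g' by auto
      then have "a * a * x = x" using 3 by (simp add: mult.assoc)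
      then have "a * a = 1" using n by simp
      then have "a = -1" using 3 n by (auto simp: square_eq_1_iff)
      then show ?thesis using gu n 3 unfolding g' by auto
    qed
  next
    assume g': "g = (\<lambda>z. a / z)"
    consider "a = x * x" | "a = u * x" | "a = v * x" using gx g' n by (auto simp: divide_eq_eq)
    then show ?thesis
    proof cases
      case 1
      then have "u * u = x * x" "v * v = x * x"
        using gu gv n s unfolding scalene_def g' by (auto simp: divide_eq_eq mult.commute)
      then have "u = -x" "v = -x" using n by (auto simp: square_eq_iff)
      then show ?thesis using n by simp
    next
      case 2
      then show ?thesis using gv n s unfolding scalene_def g' by (auto simp: divide_eq_eq mult.commute)
    next
      case 3
      then show ?thesis using gu n s unfolding scalene_def g' by (auto simp: divide_eq_eq mult.commute)
    qed
  qed
qed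

text \<open>Otherwise every \<open>u\<close> in \<open>V\<close> has only the four possible partners \<open>x\<^sup>2 / u\<close>, \<open>u\<^sup>2 / x\<close> and the
  square roots of \<open>x u\<close>; this forces \<open>u\<^sup>5 = x\<^sup>5\<close>, which cannot hold for both square roots.\<close>

lemma exists_scalene:
  assumes V: "card V \<ge> 5" "0 \<notin> V" and x: "x \<noteq> 0" "x \<notin> V"
  shows "\<exists>u\<in>V. \<exists>v\<in>V. u \<noteq> v \<and> scalene x u v"
proof (rule ccontr)
  assume neg: "\<not> ?thesis"
  have rel: "u * v = x * x \<or> u * u = x * v \<or> v * v = x * u" if "u \<in> V" "v \<in> V" "u \<noteq> v" for u v
    using neg that unfolding scalene_def by blast
  have nz: "u \<noteq> 0" if "u \<in> V" for u using V that by auto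
  have nb: "{x*x/u, u*u/x, csqrt (x*u), - csqrt (x*u)} = V - {u}" if u: "u \<in> V" for u
  proof -
    have "V - {u} \<subseteq> {x*x/u, u*u/x, csqrt (x*u), - csqrt (x*u)}"
    proof
      fix v assume v: "v \<in> V - {u}"
      then consider "u * v = x * x" | "u * u = x * v" | "v * v = x * u" using rel[of u v] u by auto
      then show "v \<in> {x*x/u, u*u/x, csqrt (x*u), - csqrt (x*u)}"
      proof cases
        case 3
        then have "v\<^sup>2 = (csqrt (x*u))\<^sup>2" by (simp add: power2_eq_square[of v])
        then have "v = csqrt (x*u) \<or> v = - csqrt (x*u)" by (simp only: power2_eq_iff)
        then show ?thesis by auto
      qed (use x nz[OF u] in \<open>auto simp: field_simps\<close>)
    qed
    moreover have "card (V - {u}) \<ge> 4" using V u by (simp add: card_Diff_singleton)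
    moreover have "card {x*x/u, u*u/x, csqrt (x*u), - csqrt (x*u)} \<le> 4"
      using card_length[of "[x*x/u, u*u/x, csqrt (x*u), - csqrt (x*u)]"] by simp
    ultimately show ?thesis
      using card_seteq[of "{x*x/u, u*u/x, csqrt (x*u), - csqrt (x*u)}" "V - {u}"] by auto
  qed
  have p5: "u ^ 5 = x ^ 5" if u: "u \<in> V" for u
  proof -
    have u0: "u \<noteq> 0" "u \<noteq> x" using nz[OF u] x u by auto
    have p: "x*x/u \<in> V" "x*x/u \<noteq> u" and q: "u*u/x \<in> V" using nb[OF u] by blast+
    have mx: "-x \<notin> V"
    proof
      assume "-x \<in> V"
      then have "x*x/(-x) \<noteq> -x" using nb[of "-x"] by blast
      then show False using x by simp
    qed
    have "x*x/u \<noteq> u*u/x"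
    proof
      assume e: "x*x/u = u*u/x"
      have "card (V - {u}) \<ge> 4" using V u by (simp add: card_Diff_singleton)
      moreover have "V - {u} = set [u*u/x, csqrt (x*u), - csqrt (x*u)]" using nb[OF u] e by auto
      ultimately show False using card_length[of "[u*u/x, csqrt (x*u), - csqrt (x*u)]"] by simp
    qed
    \<comment> \<open>Two partners of \<open>u\<close> are themselves related. The first relation
      gives \<open>u = x\<close>, the second puts \<open>- x\<close> into \<open>V\<close>, and only
      the third, \<open>u ^ 5 = x ^ 5\<close>, survives.\<close>
    from rel[OF p(1) q this] consider "(x*x/u) * (u*u/x) = x * x"
      | "(x*x/u) * (x*x/u) = x * (u*u/x)" | "(u*u/x) * (u*u/x) = x * (x*x/u)" by blast
    then show ?thesis
    proof cases
      case 1
      then show ?thesis using u0 x by (simp add: field_simps)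
    next
      case 2
      then have "(u*u - x*x) * (u*u + x*x) = 0" using u0 x by (simp add: field_simps)
      moreover have "u * u \<noteq> x * x" using p(2) u0 by (auto simp: field_simps)
      ultimately have "u * u = - (x*x)" by (simp add: add_eq_0_iff2)
      then have "u*u/x = -x" using x by (simp add: field_simps)
      then show ?thesis using q mx by simp
    next
      case 3
      then show ?thesis using u0 x by (simp add: field_simps power_numeral_reduce)
    qed
  qed
  obtain u where u: "u \<in> V" using V by fastforce
  have "csqrt (x*u) \<in> V" "- csqrt (x*u) \<in> V" using nb[OF u] by blast+
  then have "(csqrt (x*u)) ^ 5 = x ^ 5" "(- csqrt (x*u)) ^ 5 = x ^ 5" using p5 by blast+
  then have "x ^ 5 = 0" by simp
  then show False using x by simp
qed

section \<open>Colourings close to an antipodally symmetric one\<close>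

text \<open>The points of \<open>Z\<close> and their antipodes are exactly those whose antipode has
  the other colour in \<open>toggle c Z\<close>. As \<open>g\<close> commutes with negation, it
  preserves this set.\<close>

lemma antipodal_toggle_image:
  assumes c: "rot_inv (-1) c" and g: "circle_map g" "\<And>z. toggle c Z (g z) = toggle c Z z"
    and Z: "\<And>z. z \<in> Z \<Longrightarrow> - z \<notin> Z" and z: "z \<in> Z"
  shows "g z \<noteq> - z" "g z \<in> Z \<or> - g z \<in> Z"
proof -
  have m: "c (- y) = c y" for y using c by (auto simp: rot_inv_def)
  have k: "toggle c Z (- z) \<noteq> toggle c Z z" using Z[OF z] z m by (auto simp: toggle_def)
  then show "g z \<noteq> - z" using g(2)[of z] by auto
  have "toggle c Z (- g z) \<noteq> toggle c Z (g z)"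
    using k g(2)[of z] g(2)[of "-z"] circle_map_minus[OF g(1)] by simp
  then show "g z \<in> Z \<or> - g z \<in> Z" using m by (auto simp: toggle_def)
qed

text \<open>A symmetry of the toggled colouring must fix \<open>y\<close>, so it is the reflection
  in the line through \<open>y\<close>; it then preserves \<open>c\<close> as well.\<close>

lemma antipodal_single:
  assumes c: "rot_inv (-1) c" and y: "y \<noteq> 0" and s: "\<not> asymmetric (toggle c {y})"
  shows "refl_inv (y * y) c"
proof -
  obtain g where g: "circle_map g" "g \<noteq> id" "\<And>z. toggle c {y} (g z) = toggle c {y} z"
    using not_asymmetricE[OF s] by blast
  have my: "- y \<noteq> y" using y by simp
  have "g y \<noteq> - y" "g y \<in> {y} \<or> - g y \<in> {y}"
    using antipodal_toggle_image[OF c g(1,3), of y] my by auto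
  then have gy: "g y = y" by (metis minus_minus singletonD)
  obtain a where a: "a \<noteq> 0" "g = (\<lambda>z. a * z) \<or> g = (\<lambda>z. a / z)"
    using g unfolding circle_map_def by blast
  from a(2) show ?thesis
  proof
    assume "g = (\<lambda>z. a * z)"
    then show ?thesis using g(2) gy y by auto
  next
    assume g': "g = (\<lambda>z. a / z)"
    then have a': "a = y * y" using gy y by (simp add: field_simps)
    have "c (a / z) = c z" for z
    proof (cases "z = y")
      case True
      then show ?thesis using gy g' by simp
    next
      case False
      then have "a / z \<noteq> y" using y unfolding a' by (auto simp: divide_eq_eq)
      then show ?thesis using g(3)[of z] False unfolding toggle_def g' by auto
    qed
    then show ?thesis unfolding refl_inv_def a' by blast
  qed
qed

text \<open>If toggling \<open>x\<close> in \<open>c\<close> gives a colouring from the family that is free on \<open>W\<close>, then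
  \<open>toggle c Z\<close> belongs to this family iff \<open>Z\<close> is admissible.\<close>

definition admissible :: "complex set \<Rightarrow> complex \<Rightarrow> complex set \<Rightarrow> bool" where
  "admissible W x Z \<longleftrightarrow> Z - {x} \<subseteq> W \<and> (x \<in> Z \<or> x \<in> W)"

text \<open>Squaring is injective on \<open>W - {x}\<close>, so at least five squares remain, none
  of them \<open>x * x\<close>. A scalene triangle among the squares lifts to a set \<open>Z\<close>
  whose toggling leaves no symmetry.\<close>

lemma antipodal_case_no_pair:
  assumes c: "rot_inv (-1) c" and W: "card W = 6" "0 \<notin> W" and x: "x \<noteq> 0"
    and sym: "\<And>Z. admissible W x Z \<Longrightarrow> \<not> asymmetric (toggle c Z)"
    and xW: "- x \<notin> W" and np: "\<And>v. v \<in> W \<Longrightarrow> - v \<notin> W"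
  shows False
proof -
  have inj: "inj_on (\<lambda>v. v * v) (W - {x})"
  proof (rule inj_onI)
    fix u v assume "u \<in> W - {x}" "v \<in> W - {x}" "u * u = v * v"
    then show "u = v" using np[of v] by (auto simp: square_eq_iff)
  qed
  have fin: "finite W" using W card.infinite by fastforce
  have "card ((\<lambda>v. v * v) ` (W - {x})) \<ge> 5"
    unfolding card_image[OF inj] using W fin by (auto simp: card_Diff_singleton_if)
  moreover have "0 \<notin> (\<lambda>v. v * v) ` (W - {x})" using W by auto
  moreover have "x * x \<notin> (\<lambda>v. v * v) ` (W - {x})"
  proof
    assume "x * x \<in> (\<lambda>v. v * v) ` (W - {x})"
    then obtain v where "v \<in> W" "v \<noteq> x" "v * v = x * x" by fastforce
    then show False using xW by (auto simp: square_eq_iff)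
  qed
  ultimately obtain u v where uv: "u \<in> W - {x}" "v \<in> W - {x}" "u * u \<noteq> v * v"
    "scalene (x * x) (u * u) (v * v)" and xuv: "x * x \<noteq> u * u" "x * x \<noteq> v * v"
    using exists_scalene[of "(\<lambda>v. v * v) ` (W - {x})" "x * x"] x by auto
  define Z where "Z = {x, u, v}"
  have "\<not> asymmetric (toggle c Z)" using uv by (intro sym) (auto simp: Z_def admissible_def)
  then obtain g where g: "circle_map g" "g \<noteq> id" "\<And>z. toggle c Z (g z) = toggle c Z z"
    using not_asymmetricE by blast
  have nz: "u \<noteq> 0" "v \<noteq> 0" using uv W by auto
  have ZZ: "- z \<notin> Z" if "z \<in> Z" for z
  proof
    assume "- z \<in> Z"
    moreover have "- z \<noteq> z" using that x nz by (auto simp: Z_def)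
    moreover have "(- z) * (- z) = z * z" by simp
    ultimately show False using that xuv uv(3) unfolding Z_def by (metis insertE singletonD)
  qed
  \<comment> \<open>Squaring passes to the quotient of the circle by the antipodal map.\<close>
  have gsq: "g z * g z \<in> {x * x, u * u, v * v}" if "z \<in> Z" for z
  proof -
    have "g z \<in> Z \<or> - g z \<in> Z" using antipodal_toggle_image[OF c g(1,3) ZZ that] by blast
    moreover have "(- g z) * (- g z) = g z * g z" by simp
    ultimately show ?thesis unfolding Z_def by (metis insertE insertI1 insertI2 singletonD)
  qed
  obtain a where a: "a \<noteq> 0" "g = (\<lambda>z. a * z) \<or> g = (\<lambda>z. a / z)"
    using g unfolding circle_map_def by blast
  have sc: "h = id" if "circle_map h" "\<And>z. h (z*z) = g z * g z" for h
    using scalene_rigid[OF that(1) _ _ _ xuv uv(3) uv(4)] gsq[of x] gsq[of u] gsq[of v] that(2) x nz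
    by (auto simp: Z_def)
  from a(2) show False
  proof
    assume g': "g = (\<lambda>z. a * z)"
    have "(\<lambda>z. (a*a) * z) = id"
      by (rule sc) (use a in \<open>auto simp: g' intro: circle_mapI\<close>)
    then have "a * a = 1" by (metis id_apply mult.right_neutral)
    then have "a = 1 \<or> a = -1" by (simp add: square_eq_1_iff)
    moreover have "a \<noteq> 1" using g(2) g' by auto
    ultimately have "g x = - x" using g' by simp
    then show False using antipodal_toggle_image(1)[OF c g(1,3) ZZ, of x] by (auto simp: Z_def)
  next
    assume g': "g = (\<lambda>z. a / z)"
    have "(\<lambda>z. (a*a) / z) = id"
      by (rule sc) (use a in \<open>auto simp: g' intro: circle_mapI\<close>)
    then have "(a*a) / 1 = 1" "(a*a) / 2 = 2" by (metis id_apply)+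
    then show False by simp
  qed
qed

lemma rot_inv_toggle_antipodal:
  assumes "rot_inv (-1) c"
  shows "rot_inv (-1) (toggle c {v, - v})"
proof -
  have "c (- z) = c z" for z using assms by (auto simp: rot_inv_def)
  moreover have "- z \<in> {v, - v} \<longleftrightarrow> z \<in> {v, - v}" for z by (metis insert_iff minus_minus singletonD)
  ultimately show ?thesis by (simp add: rot_inv_def toggle_def del: insert_iff)
qed

text \<open>\<open>c\<close> and \<open>toggle c {v, - v}\<close> are both antipodally symmetric, hence both are invariant under the
  reflection that fixes \<open>y\<close>, so this reflection maps \<open>v\<close> to \<open>\<plusminus> v\<close>.\<close>

lemma antipodal_pair_orthogonal:
  assumes c: "rot_inv (-1) c" and v: "v \<noteq> 0" "v \<noteq> y" "v \<noteq> - y" and y: "y \<noteq> 0"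
    and s: "\<not> asymmetric (toggle c {y})" "\<not> asymmetric (toggle c {y, v, - v})"
  shows "v * v = - (y * y)"
proof -
  have c': "rot_inv (-1) (toggle c {v, - v})"
    by (rule rot_inv_toggle_antipodal[OF c])
  have "toggle c {y, v, - v} = toggle (toggle c {v, - v}) {y}"
    using v by (auto simp: toggle_def fun_eq_iff)
  then have r': "refl_inv (y * y) (toggle c {v, - v})"
    using antipodal_single[OF c' y] s by simp
  have "refl_inv (y * y) c" using antipodal_single[OF c y] s by blast
  then have "y * y / v \<in> {v, - v}"
    using r' unfolding refl_inv_def toggle_def by blast
  then have "y * y = v * v \<or> y * y = - (v * v)" using v by (auto simp: field_simps)
  then show ?thesis using v by (auto simp: square_eq_iff)
qed

text \<open>A symmetry acts on the squares \<open>x * x\<close> and \<open>u * u\<close>, whose own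
  squares differ. Hence a rotation could only be \<open>\<plusminus> 1\<close>, and a reflection
  must exchange the two lines through \<open>x\<close> and \<open>u\<close>.\<close>

lemma antipodal_double:
  assumes c: "rot_inv (-1) c" and n: "x \<noteq> 0" "u \<noteq> 0" "u * u \<noteq> x * x" "u * u \<noteq> - (x * x)"
    and s: "\<not> asymmetric (toggle c {x, u})"
  shows "\<exists>b. (b = x * u \<or> b = - (x * u)) \<and> refl_inv b (toggle c {x, u})"
proof -
  obtain g where g: "circle_map g" "g \<noteq> id" "\<And>z. toggle c {x,u} (g z) = toggle c {x,u} z"
    using not_asymmetricE[OF s] by blast
  have Z: "- z \<notin> {x, u}" if "z \<in> {x, u}" for z
    using that n by auto
  have im: "g x \<noteq> - x" "g u \<noteq> - u" "g x \<in> {x, u} \<or> - g x \<in> {x, u}" "g u \<in> {x, u} \<or> - g u \<in> {x, u}"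
    using antipodal_toggle_image[OF c g(1,3) Z] by auto
  have sq: "(- z) * (- z) = z * z" for z :: complex by simp
  have im2: "g x * g x \<in> {x*x, u*u}" "g u * g u \<in> {x*x, u*u}"
    using im(3,4) sq by (metis insertCI insertE singletonD)+
  obtain a where a: "a \<noteq> 0" "g = (\<lambda>z. a * z) \<or> g = (\<lambda>z. a / z)"
    using g unfolding circle_map_def by blast
  from a(2) show ?thesis
  proof
    assume g': "g = (\<lambda>z. a * z)"
    have "(a*a)*(x*x) \<in> {x*x, u*u}" "(a*a)*(u*u) \<in> {x*x, u*u}"
      using im2 by (simp_all add: g' ac_simps)
    then consider "(a*a)*(x*x) = x*x" | "(a*a)*(x*x) = u*u" "(a*a)*(u*u) = x*x"
      using n by auto
    then have "(u*u)*(u*u) = (x*x)*(x*x) \<or> a*a = 1"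
    proof cases
      case 2
      then have "(u*u)*(u*u) = (x*x)*(x*x)" by (metis mult.assoc mult.commute)
      then show ?thesis ..
    qed (use n in auto)
    then have "a * a = 1" using n by (simp add: square_eq_iff)
    then have "a = 1 \<or> a = -1" by (simp add: square_eq_1_iff)
    then show ?thesis using g(2) im(1) g' by auto
  next
    assume g': "g = (\<lambda>z. a / z)"
    have "refl_inv a (toggle c {x,u})" using g(3) by (simp add: refl_inv_def g')
    moreover have "a = x * u \<or> a = - (x * u)"
    proof -
      have *: "a*a = (x*x)*(x*x) \<or> a*a = (u*u)*(x*x)" "a*a = (x*x)*(u*u) \<or> a*a = (u*u)*(u*u)"
        using im2 n by (simp_all add: g' field_simps)
      have "(x*x)*(x*x) \<noteq> (u*u)*(u*u)" using n by (auto simp: square_eq_iff)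
      then have "a * a = (x * u) * (x * u)" using * n by (auto simp: ac_simps)
      then show ?thesis by (simp only: square_eq_iff)
    qed
    ultimately show ?thesis by blast
  qed
qed

text \<open>Toggling an antipodal pair of \<open>W\<close> keeps the antipodal symmetry, so the
  symmetries before and after this toggling can be compared. They agree, and hence the pair must lie
  on or perpendicular to their axis.\<close>

lemma antipodal_case_aux:
  assumes c: "rot_inv (-1) c" and W: "card W = 6" "0 \<notin> W" and x: "x \<noteq> 0"
    and sym: "\<And>Z. admissible W x Z \<Longrightarrow> \<not> asymmetric (toggle c Z)"
    and xW: "x \<in> W \<or> - x \<notin> W"
  shows False
proof (cases "\<exists>v\<in>W. - v \<in> W")
  case False
  then show False using antipodal_case_no_pair[OF c W x sym] xW by blast
next
  case True
  then obtain p where p: "p \<in> W" "- p \<in> W" by blast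
  have p0: "p \<noteq> 0" using p W by auto
  have orth: "p * p = - (y * y)" if "y = x \<or> x \<in> W \<and> y \<in> W" "y \<noteq> p" "y \<noteq> - p" for y
  proof (rule antipodal_pair_orthogonal[OF c p0])
    show "y \<noteq> 0" using that x W by auto
    show "\<not> asymmetric (toggle c {y})" "\<not> asymmetric (toggle c {y, p, - p})"
      using that p by (auto intro!: sym simp: admissible_def)
  qed (use that in auto)
  have small: "\<not> W \<subseteq> set l" if "length l \<le> 5" for l
  proof
    assume "W \<subseteq> set l"
    then have "card W \<le> card (set l)" by (intro card_mono) auto
    then show False using that card_length[of l] W by simp
  qed
  show False
  proof (cases "x \<in> W")
    case True
    \<comment> \<open>Here orthogonality applies to every point of \<open>W\<close> outside the
      pair, leaving only four possible positions.\<close>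
    have "W \<subseteq> set [p, - p, \<i> * p, - (\<i> * p)]"
    proof
      fix y assume y: "y \<in> W"
      show "y \<in> set [p, - p, \<i> * p, - (\<i> * p)]"
      proof (cases "y = p \<or> y = - p")
        case False
        then have "p * p = - (y * y)" using orth y True by blast
        then have "y * y = (\<i> * p) * (\<i> * p)" by (simp add: algebra_simps)
        then have "y = \<i> * p \<or> y = - (\<i> * p)" by (simp only: square_eq_iff)
        then show ?thesis by auto
      qed auto
    qed
    moreover have "\<not> W \<subseteq> set [p, - p, \<i> * p, - (\<i> * p)]" by (rule small) simp
    ultimately show False by blast
  next
    case False
    then have xp: "x \<noteq> p" "x \<noteq> - p" using p xW by auto
    then have pp: "p * p = - (x * x)" using orth by blast
    have "\<not> W \<subseteq> set [p, - p]" by (rule small) simp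
    then obtain u where u: "u \<in> W" "u \<noteq> p" "u \<noteq> - p" by auto
    have ux: "u \<noteq> x" "u \<noteq> - x" "u \<noteq> 0" using False xW u W by auto
    have u2: "u * u \<noteq> x * x" using ux by (auto simp: square_eq_iff)
    have u3: "u * u \<noteq> - (x * x)" using u unfolding pp[symmetric] by (auto simp: square_eq_iff)
    have c': "rot_inv (-1) (toggle c {p, - p})"
      by (rule rot_inv_toggle_antipodal[OF c])
    have e: "toggle c {x, u, p, - p} = toggle (toggle c {p, - p}) {x, u}"
      using xp u by (auto simp: toggle_def fun_eq_iff)
    have "\<not> asymmetric (toggle c {x, u})" "\<not> asymmetric (toggle c {x, u, p, - p})"
      using p u by (auto intro!: sym simp: admissible_def)
    then obtain b b' where b: "b = x * u \<or> b = - (x * u)" "refl_inv b (toggle c {x, u})"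
      and b': "b' = x * u \<or> b' = - (x * u)" "refl_inv b' (toggle (toggle c {p, - p}) {x, u})"
      using antipodal_double[OF c x ux(3) u2 u3] antipodal_double[OF c' x ux(3) u2 u3] unfolding e by blast
    have m: "c (- z) = c z" for z using c by (auto simp: rot_inv_def)
    have bx: "b / x = u \<or> b / x = - u" "b' / x = u \<or> b' / x = - u" using b b' x by auto
    have "toggle c {x, u} (b / x) = toggle c {x, u} x" "toggle c {x, u} (b' / x) = toggle c {x, u} x"
    proof -
      show "toggle c {x, u} (b / x) = toggle c {x, u} x" using b(2) by (simp add: refl_inv_def)
      have "toggle (toggle c {p, - p}) {x, u} (b' / x) = toggle (toggle c {p, - p}) {x, u} x"
        using b'(2) by (simp add: refl_inv_def)
      moreover have "b' / x \<notin> {p, - p}" using bx(2) u by auto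
      ultimately show "toggle c {x, u} (b' / x) = toggle c {x, u} x"
        using xp by (auto simp: toggle_def)
    qed
    moreover have "toggle c {x, u} (- u) \<noteq> toggle c {x, u} u" using ux by (auto simp: toggle_def m)
    \<comment> \<open>Both reflections send \<open>x\<close> to \<open>u\<close> or
      \<open>- u\<close>, and these two points have different colours in
      \<open>toggle c {x, u}\<close>.\<close>
    ultimately have "b / x = b' / x" using bx by metis
    then have "b = b'" using x by simp
    have "b / p \<in> {p, - p}"
    proof -
      have "(toggle c {x, u} (b / p) \<noteq> (b / p \<in> {p, - p})) = (toggle c {x, u} p \<noteq> (p \<in> {p, - p}))"
        using b'(2) \<open>b = b'\<close> by (auto simp: refl_inv_def toggle_def)
      moreover have "toggle c {x, u} (b / p) = toggle c {x, u} p" using b(2) by (simp add: refl_inv_def)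
      ultimately show ?thesis by auto
    qed
    then have "b = p * p \<or> b = - (p * p)" using p0 by (auto simp: field_simps)
    then have "x * u = x * x \<or> x * u = - (x * x)" using b(1) unfolding pp by auto
    then have "x * (u - x) = 0 \<or> x * (u + x) = 0" by (auto simp: algebra_simps)
    then show False using x ux by (auto simp: add_eq_0_iff2)
  qed
qed

text \<open>If \<open>x\<close> is outside \<open>W\<close> but \<open>- x\<close> is inside,
  toggling this antipodal pair in \<open>c\<close> preserves the symmetry and lets
  \<open>- x\<close> take the role of \<open>x\<close>.\<close>

lemma antipodal_case:
  assumes c: "rot_inv (-1) c" and W: "card W = 6" "0 \<notin> W" and x: "x \<noteq> 0"
    and sym: "\<And>Z. admissible W x Z \<Longrightarrow> \<not> asymmetric (toggle c Z)"
  shows False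
proof (cases "x \<in> W \<or> - x \<notin> W")
  case True
  then show False using antipodal_case_aux[OF c W x sym] by blast
next
  case False
  show False
  proof (rule antipodal_case_aux)
    show "rot_inv (-1) (toggle c {x, - x})" by (rule rot_inv_toggle_antipodal[OF c])
    fix Z assume Z: "admissible W (- x) Z"
    have "x \<noteq> - x" using x by simp
    then have "admissible W x (({x, - x} - Z) \<union> (Z - {x, - x}))"
      using False Z by (auto simp: admissible_def)
    then show "\<not> asymmetric (toggle (toggle c {x, - x}) Z)"
      unfolding toggle_toggle by (rule sym)
  qed (use x W False in auto)
qed

section \<open>Colourings close to one with a rotation of higher order\<close>

lemma rot_inv_mult: "rot_inv a c \<Longrightarrow> rot_inv b c \<Longrightarrow> rot_inv (a * b) c"
  by (simp add: rot_inv_def mult.assoc)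

lemma rot_inv_inverse: "rot_inv a c \<Longrightarrow> a \<noteq> 0 \<Longrightarrow> rot_inv (1 / a) c"
proof -
  assume a: "rot_inv a c" "a \<noteq> 0"
  have "c (1 / a * z) = c z" for z
    using a(1)[unfolded rot_inv_def, rule_format, of "z / a"] a(2) by simp
  then show ?thesis by (simp add: rot_inv_def)
qed

text \<open>If \<open>g z\<close> left \<open>Z\<close>, its colour in \<open>c\<close> would differ
  from \<open>\<alpha>\<close>, and so would that of the image of the rotated point
  \<open>h * z\<close>. But \<open>h * z\<close> is an untoggled point of colour
  \<open>\<alpha>\<close>, so its colour would not be preserved.\<close>

lemma monochrome_toggle_image:
  assumes g: "circle_map g" "\<And>y. toggle c Z (g y) = toggle c Z y"
    and mono: "\<And>y. y \<in> Z \<Longrightarrow> c y = \<alpha>" and z: "z \<in> Z"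
    and h: "h \<noteq> 0" "rot_inv h c" "h * z \<notin> Z"
  shows "g z \<in> Z"
proof (rule ccontr)
  assume "g z \<notin> Z"
  then have "c (g z) \<noteq> \<alpha>" using g(2)[of z] mono[OF z] z by (auto simp: toggle_def)
  then have ne: "c (g (h * z)) \<noteq> \<alpha>" using circle_map_rot_inv[OF g(1) h(2,1)] by simp
  then have "g (h * z) \<notin> Z" using mono by blast
  moreover have "c (h * z) = \<alpha>" using h mono[OF z] by (simp add: rot_inv_def)
  ultimately show False using g(2)[of "h * z"] h(3) ne by (auto simp: toggle_def)
qed

lemma circle_map_pair:
  assumes g: "circle_map g" "g \<noteq> id" and n: "x \<noteq> 0" "u \<noteq> 0" "u \<noteq> x" "u \<noteq> - x"
    and im: "g x \<in> {x, u}" "g u \<in> {x, u}"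
  shows "g = (\<lambda>z. x * u / z)"
proof -
  obtain a where a: "a \<noteq> 0" "g = (\<lambda>z. a * z) \<or> g = (\<lambda>z. a / z)"
    using g unfolding circle_map_def by blast
  have "g x \<noteq> g u" using circle_map_inj[OF g(1), of x u] n(3) by auto
  then have im': "g x = x \<and> g u = u \<or> g x = u \<and> g u = x" using im by auto
  from a(2) show ?thesis
  proof
    assume g': "g = (\<lambda>z. a * z)"
    then have "a \<noteq> 1" using g(2) by auto
    then have "a * x = u" "a * u = x" using im' n unfolding g' by auto
    then have "u * u = x * x" by (metis mult.assoc mult.commute)
    then show ?thesis using n by (auto simp: square_eq_iff)
  next
    assume g': "g = (\<lambda>z. a / z)"
    then have "a = x * x \<and> a = u * u \<or> a = x * u" using im' n by (auto simp: field_simps)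
    moreover have "x * x \<noteq> u * u" using n by (auto simp: square_eq_iff)
    ultimately show ?thesis using g' by auto
  qed
qed

text \<open>If \<open>g x\<close> left the pair, then \<open>g\<close> would have to send both
  \<open>a * x\<close> and \<open>x / a\<close> to \<open>u\<close>, although these points are
  distinct because \<open>a\<close> has order greater than two.\<close>

lemma pair_toggle_image:
  assumes g: "circle_map g" "\<And>y. toggle c {x, u} (g y) = toggle c {x, u} y"
    and a: "rot_inv a c" "a \<noteq> 0" "a \<noteq> 1" "a \<noteq> -1" and x: "x \<noteq> 0" "x \<noteq> u"
  shows "g x \<in> {x, u}"
proof (rule ccontr)
  assume neg: "g x \<notin> {x, u}"
  then have ne: "c (g x) \<noteq> c x" using g(2)[of x] by (auto simp: toggle_def)
  have *: "g (h * x) = u" "c u \<noteq> c x" if h: "rot_inv h c" "h \<noteq> 0" "h \<noteq> 1" "h * x \<noteq> u" for h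
  proof -
    have "h * x \<notin> {x, u}" using h x by auto
    moreover have "c (h * x) = c x" using h by (simp add: rot_inv_def)
    moreover have "c (g (h * x)) = c (g x)" by (rule circle_map_rot_inv[OF g(1) h(1,2)])
    ultimately have "g (h * x) \<in> {x, u}" "g (h * x) \<noteq> x" using g(2)[of "h * x"] ne by (auto simp: toggle_def)
    then show "g (h * x) = u" by blast
    then show "c u \<noteq> c x" using \<open>c (g (h * x)) = c (g x)\<close> ne by simp
  qed
  have i: "rot_inv (1/a) c" using rot_inv_inverse a by blast
  have aa: "a * a \<noteq> 1" using a by (simp add: square_eq_1_iff)
  then have d: "a * x \<noteq> 1/a * x" using x a by (auto simp: field_simps)
  have "a * x = u \<Longrightarrow> c u = c x" "1/a * x = u \<Longrightarrow> c u = c x"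
    using a(1) i by (auto simp: rot_inv_def)
  moreover have "a * x \<noteq> u \<or> 1/a * x \<noteq> u" using d by metis
  ultimately have "a * x \<noteq> u" "1/a * x \<noteq> u" using *(2)[of a] *(2)[of "1/a"] a i by auto
  then have "g (a * x) = g (1/a * x)" using *(1)[of a] *(1)[of "1/a"] a i by auto
  then show False using d circle_map_inj[OF g(1)] by blast
qed

lemma refl_inv_toggle_pair:
  assumes "x \<noteq> 0" "u \<noteq> 0" and k: "refl_inv (x * u) (toggle c {x, u})"
  shows "refl_inv (x * u) c"
proof -
  have "c (x * u / z) = c z" for z
  proof -
    have "x * u / z \<in> {x, u} \<longleftrightarrow> z \<in> {x, u}"
      using assms by (cases "z = 0") (auto simp: divide_eq_eq)
    moreover have "toggle c {x, u} (x * u / z) = toggle c {x, u} z"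
      using k by (simp only: refl_inv_def)
    ultimately show ?thesis unfolding toggle_def by blast
  qed
  then show ?thesis by (simp add: refl_inv_def)
qed

text \<open>Toggling \<open>x\<close> with a point of \<open>V\<close> forces many reflections of
  \<open>c\<close>; their compositions make \<open>c\<close> invariant under all quotients of points
  of \<open>V\<close>. Then toggling a scalene triangle destroys every symmetry.\<close>

lemma rotation_case:
  assumes a: "rot_inv a c" "a \<noteq> 0" "a \<noteq> 1" "a \<noteq> -1"
    and W: "card W = 6" "0 \<notin> W" and x: "x \<noteq> 0"
    and sym: "\<And>Z. admissible W x Z \<Longrightarrow> \<not> asymmetric (toggle c Z)"
  shows False
proof -
  define V where "V = W - {x, - x}"
  have fin: "finite W" using W card.infinite by fastforce
  have nz: "u \<noteq> 0" "u \<noteq> x" "u \<noteq> - x" "u \<in> W" if "u \<in> V" for u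
    using that W by (auto simp: V_def)
  \<comment> \<open>At least four points of \<open>W\<close> remain in \<open>V\<close>, so three of
    them can always be avoided.\<close>
  have small: "\<exists>u\<in>V. u \<notin> set l" if "length l \<le> 3" for l
  proof (rule ccontr)
    assume "\<not> ?thesis"
    then have "W \<subseteq> set (x # - x # l)" by (auto simp: V_def)
    then have "card W \<le> card (set (x # - x # l))" by (intro card_mono) auto
    then show False using that card_length[of "x # - x # l"] W by simp
  qed
  have refl: "refl_inv (x * u) c" if u: "u \<in> V" for u
  proof -
    have "\<not> asymmetric (toggle c {x, u})"
      using nz[OF u] by (intro sym) (auto simp: admissible_def)
    then obtain g where g: "circle_map g" "g \<noteq> id" "\<And>z. toggle c {x, u} (g z) = toggle c {x, u} z"
      using not_asymmetricE by blast
    have "g x \<in> {x, u}" using pair_toggle_image[OF g(1,3) a x] nz[OF u] by simp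
    moreover have "g u \<in> {x, u}"
      using pair_toggle_image[of g c u x] g a nz[OF u] by (simp add: insert_commute)
    ultimately have "g = (\<lambda>z. x * u / z)" using circle_map_pair[OF g(1,2) x] nz[OF u] by simp
    then have "refl_inv (x * u) (toggle c {x, u})" using g(3) by (simp add: refl_inv_def)
    then show ?thesis using refl_inv_toggle_pair x nz[OF u] by blast
  qed
  have colour: "c u = c x" if "u \<in> V" for u
  proof -
    have "c (x * u / x) = c x" using refl[OF that] by (simp only: refl_inv_def)
    then show ?thesis using x by simp
  qed
  have rot: "rot_inv (u / v) c" if "u \<in> V" "v \<in> V" for u v
  proof -
    have "c (u / v * z) = c z" for z
    proof (cases "z = 0")
      case False
      have "c (x * u / (x * v / z)) = c z"
        using refl[OF that(1)] refl[OF that(2)] by (simp only: refl_inv_def)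
      moreover have "x * u / (x * v / z) = u / v * z" using x nz[OF that(2)] False by (simp add: field_simps)
      ultimately show ?thesis by simp
    qed simp
    then show ?thesis by (simp add: rot_inv_def)
  qed
  have no_scalene: "\<not> scalene x u v" if u: "u \<in> V" and v: "v \<in> V" and uv: "u \<noteq> v" for u v
  proof
    assume sc: "scalene x u v"
    \<comment> \<open>The rotations \<open>t / u\<close> and \<open>t / v\<close> carry
      \<open>u\<close> and \<open>v\<close> out of the triangle, as
      \<open>monochrome_toggle_image\<close> requires.\<close>
    obtain t where t: "t \<in> V" "t \<noteq> u" "t \<noteq> v" using small[of "[u, v]"] by auto
    have "\<not> asymmetric (toggle c {x, u, v})"
      using nz[OF u] nz[OF v] by (intro sym) (auto simp: admissible_def)
    then obtain g where g: "circle_map g" "g \<noteq> id" "\<And>z. toggle c {x, u, v} (g z) = toggle c {x, u, v} z"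
      using not_asymmetricE by blast
    have im: "g z \<in> {x, u, v}" if "z \<in> {x, u, v}" "rot_inv h c" "h \<noteq> 0" "h * z \<notin> {x, u, v}" for z h
      using monochrome_toggle_image[OF g(1,3), of "c x" z h] that colour u v by auto
    have "g u \<in> {x, u, v}" "g v \<in> {x, u, v}"
      using im[of u "t / u"] im[of v "t / v"] rot[OF t(1)] u v t nz[OF t(1)] nz[OF u] nz[OF v] by auto
    moreover have "g x \<in> {x, u, v}"
    proof (cases "rot_inv (x / u) c")
      case True
      then have "rot_inv (1 / (x / u)) c" by (rule rot_inv_inverse) (use x nz[OF u] in auto)
      with rot[OF t(1) u] have "rot_inv ((t / u) * (1 / (x / u))) c" by (rule rot_inv_mult)
      then have "rot_inv (t / x) c" using nz[OF u] by (simp add: field_simps)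
      then show ?thesis using im[of x "t / x"] t nz[OF t(1)] x by auto
    next
      case False
      have "t / u * x \<noteq> s" if s: "s \<in> V" for s
      proof
        assume "t / u * x = s"
        then have "x / u = s / t" using nz[OF t(1)] nz[OF u] by (auto simp: field_simps)
        then show False using False rot[OF s t(1)] by simp
      qed
      moreover have "t / u * x \<noteq> x" using t x nz[OF u] by (auto simp: divide_eq_eq)
      ultimately have "t / u * x \<notin> {x, u, v}" using u v by blast
      then show ?thesis using im[of x "t / u"] rot[OF t(1) u] nz[OF t(1)] nz[OF u] by auto
    qed
    ultimately have "g = id"
      using scalene_rigid[OF g(1) x _ _ _ _ uv sc] nz[OF u] nz[OF v] by auto
    then show False using g(2) by blast
  qed
  have mx: "- x \<in> W"
  proof (rule ccontr)
    assume "- x \<notin> W"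
    then have V': "V = W - {x}" by (auto simp: V_def)
    then have "card V \<ge> 5" using W fin by (auto simp: card_Diff_singleton_if)
    then show False using exists_scalene[of V x] no_scalene W x V' by auto
  qed
  have rotx: "rot_inv (u / x) c" if u: "u \<in> V" for u
  proof (rule ccontr)
    assume n: "\<not> rot_inv (u / x) c"
    obtain v where v: "v \<in> V" "v \<noteq> u" "v \<noteq> x * x / u" using small[of "[u, x * x / u]"] by auto
    have "u * v \<noteq> x * x" using v nz[OF u] by (auto simp: field_simps)
    moreover have "u * u \<noteq> x * v"
    proof
      assume "u * u = x * v"
      then have "u / x = v / u" using x nz[OF u] by (simp add: field_simps)
      then show False using n rot[OF v(1) u] by simp
    qed
    moreover have "v * v \<noteq> x * u"
    proof
      assume "v * v = x * u"
      then have "u / x = (u / v) * (u / v)" using x nz[OF u] nz[OF v(1)] by (simp add: field_simps)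
      then show False using n rot_inv_mult[OF rot[OF u v(1)] rot[OF u v(1)]] by simp
    qed
    ultimately show False using no_scalene[OF u v(1)] v by (auto simp: scalene_def)
  qed
  \<comment> \<open>Avoiding \<open>\<plusminus> \<i> * x\<close> makes the triangle
    \<open>x\<close>, \<open>- x\<close>, \<open>u\<close> scalene.\<close>
  obtain u where u: "u \<in> V" "u \<noteq> \<i> * x" "u \<noteq> - (\<i> * x)" using small[of "[\<i> * x, - (\<i> * x)]"] by auto
  have uu: "u * u \<noteq> - (x * x)"
  proof
    assume "u * u = - (x * x)"
    then have "u * u = (\<i> * x) * (\<i> * x)" by (simp add: algebra_simps)
    then show False using u by (simp only: square_eq_iff) auto
  qed
  note u0 = nz[OF u(1)]
  have xx: "x \<noteq> - x" using x by simp
  obtain t where t: "t \<in> V" "t \<noteq> u" "t \<noteq> - u" using small[of "[u, - u]"] by auto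
  note t0 = nz[OF t(1)]
  have "\<not> asymmetric (toggle c {x, - x, u})"
    using u0 mx by (intro sym) (auto simp: admissible_def)
  then obtain g where g: "circle_map g" "g \<noteq> id" "\<And>z. toggle c {x, - x, u} (g z) = toggle c {x, - x, u} z"
    using not_asymmetricE by blast
  show False
  proof (cases "c (- x) = c x")
    case True
    have im: "g z \<in> {x, - x, u}" if "z \<in> {x, - x, u}" "rot_inv h c" "h \<noteq> 0" "h * z \<notin> {x, - x, u}" for z h
      using monochrome_toggle_image[OF g(1,3), of "c x" z h] that colour[OF u(1)] True by auto
    have "- t \<noteq> x" "- t \<noteq> u" using t0 t by (metis minus_minus)+
    then have im3: "g x \<in> {x, - x, u}" "g (- x) \<in> {x, - x, u}" "g u \<in> {x, - x, u}"
      using im[of x "t / x"] im[of "- x" "t / x"] im[of u "t / u"] rotx[OF t(1)] rot[OF t(1) u(1)] t t0 u0 x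
      by auto
    have "(- x) * u \<noteq> x * x"
    proof
      assume "(- x) * u = x * x"
      then have "x * (- u) = x * x" by simp
      then have "- u = x" using x by (metis mult_left_cancel)
      then show False using u0 by (metis minus_minus)
    qed
    then have "scalene x (- x) u" using u0 uu x by (auto simp: scalene_def)
    then have "g = id" using scalene_rigid[OF g(1), of x "- x" u] x xx u0 im3 by auto
    then show False using g(2) by blast
  next
    case False
    obtain s where s: "s \<in> V" "s \<noteq> u" "s \<noteq> t" using small[of "[u, t]"] by auto
    \<comment> \<open>If \<open>g\<close> moved \<open>y\<close> out of the pair, all points of
      \<open>V\<close> other than \<open>u\<close> would be sent to \<open>- x\<close>;
      \<open>s\<close> and \<open>t\<close> are two of them.\<close>
    have im: "g y \<in> {x, u}" if y: "y \<in> {x, u}" for y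
    proof (rule ccontr)
      assume n: "g y \<notin> {x, u}"
      have cy: "c y = c x" using y colour u by auto
      have "c (g y) \<noteq> c x"
        using g(3)[of y] n y cy False by (auto simp: toggle_def)
      have *: "g r = - x" if r: "r \<in> V" "r \<noteq> u" for r
      proof -
        have "rot_inv (r / y) c" using rotx[OF r(1)] rot[OF r(1) u(1)] y by auto
        then have "c (g (r / y * y)) = c (g y)"
          using nz[OF r(1)] u0 x y by (intro circle_map_rot_inv[OF g(1)]) auto
        then have "c (g r) \<noteq> c x" using \<open>c (g y) \<noteq> c x\<close> y u0 x by auto
        then show ?thesis
          using g(3)[of r] colour[OF r(1)] colour[OF u(1)] nz[OF r(1)] r(2) by (auto simp: toggle_def)
      qed
      then have "g t = g s" using t s by simp
      then show False using circle_map_inj[OF g(1)] s by simp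
    qed
    then have g': "g = (\<lambda>z. x * u / z)" using circle_map_pair[OF g(1,2) x] u0 by simp
    have gm: "g (- x) = - u" using x by (simp add: g')
    have "c (u / x * (- x)) = c (- x)" using rotx[OF u(1)] by (simp only: rot_inv_def)
    then have cu: "c (- u) = c (- x)" using x by simp
    have "- u \<noteq> x" using u0 by (metis minus_minus)
    moreover have "- u \<noteq> u" "- u \<noteq> - x" using u0 by auto
    ultimately show False using g(3)[of "- x"] cu by (auto simp: gm toggle_def)
  qed
qed

section \<open>From the circle to the plane\<close>

text \<open>Either all colourings in the family are rigid, or one is at Hamming distance at most one
  from a colouring with rotational symmetry, which then serves as the base colouring of the
  preceding sections.\<close>

lemma six_points_asymmetric:
  assumes W: "card W = 6" "0 \<notin> W"
  shows "\<exists>S\<subseteq>W. asymmetric (toggle c S)"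
proof (cases "\<forall>S\<subseteq>W. rot_rigid (toggle c S)")
  case True
  then show ?thesis using asymmetric_if_rigid[OF W] by blast
next
  case False
  then obtain S where S: "S \<subseteq> W" "\<not> rot_rigid (toggle c S)" by blast
  obtain T x a where T: "rot_inv a (toggle c T)" "a \<noteq> 0" "a \<noteq> 1" "x \<noteq> 0"
    "\<And>Z. admissible W x Z \<Longrightarrow> (T - Z) \<union> (Z - T) \<subseteq> W"
  proof -
    consider a where "a \<noteq> 0" "a \<noteq> 1" "rot_inv a (toggle c S)"
      | a y where "a \<noteq> 0" "a \<noteq> 1" "y \<noteq> 0" "rot_inv a (toggle (toggle c S) {y})"
      using S(2) unfolding rot_rigid_def by blast
    then show ?thesis
    proof cases
      case 1
      \<comment> \<open>At distance zero any point of \<open>W\<close> may serve as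
        \<open>x\<close>, since toggling it stays within the family.\<close>
      obtain x where x: "x \<in> W" using W by fastforce
      show ?thesis
        by (rule that[of a S x]) (use 1 x W S in \<open>auto simp: admissible_def\<close>)
    next
      case 2
      show ?thesis
        by (rule that[of a "(S - {y}) \<union> ({y} - S)" y])
          (use 2 S in \<open>auto simp: admissible_def toggle_toggle\<close>)
    qed
  qed
  show ?thesis
  proof (rule ccontr)
    assume "\<not> ?thesis"
    then have sym: "\<not> asymmetric (toggle (toggle c T) Z)" if "admissible W x Z" for Z
      using T(5)[OF that] unfolding toggle_toggle by blast
    show False
    proof (cases "a = -1")
      case True
      then show False using antipodal_case[OF _ W T(4) sym] T(1) by simp
    next
      case False
      then show False using rotation_case[OF T(1-3) _ W T(4) sym] by simp
    qed
  qed
qed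

definition plane_asymmetric :: "(complex \<Rightarrow> bool) \<Rightarrow> bool" where
  "plane_asymmetric c \<longleftrightarrow> (\<forall>a. cmod a = 1 \<longrightarrow> (\<forall>z. c (a * z) = c z) \<longrightarrow> a = 1) \<and>
     (\<forall>b. cmod b = 1 \<longrightarrow> \<not> (\<forall>z. c (b * cnj z) = c z))"

text \<open>On the circle of radius \<open>\<rho>\<close> the reflection \<open>b * cnj z\<close>
  coincides with \<open>b * \<rho>\<^sup>2 / z\<close>. Erasing \<open>c\<close> off the circle
  therefore reduces the claim to the multiplicative group.\<close>

lemma one_circle_asymmetric:
  assumes W: "card W = 6" "\<And>w. w \<in> W \<Longrightarrow> cmod w = \<rho>" and \<rho>: "\<rho> > 0"
  shows "\<exists>S\<subseteq>W. plane_asymmetric (toggle c S)"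
proof -
  define k where "k z \<longleftrightarrow> c z \<and> cmod z = \<rho>" for z
  have "0 \<notin> W" using W(2)[of 0] \<rho> by auto
  then obtain S where S: "S \<subseteq> W" "asymmetric (toggle k S)"
    using six_points_asymmetric[OF W(1)] by blast
  have on: "toggle k S z = toggle c S z" if "cmod z = \<rho>" for z
    using that by (simp add: toggle_def k_def)
  have off: "\<not> toggle k S z" if "cmod z \<noteq> \<rho>" for z
    using that S(1) W(2) by (auto simp: toggle_def k_def)
  have "a = 1" if a: "cmod a = 1" "\<And>z. toggle c S (a * z) = toggle c S z" for a
  proof -
    have "toggle k S (a * z) = toggle k S z" for z
      using on[of z] off[of z] on[of "a * z"] off[of "a * z"] a by (cases "cmod z = \<rho>") (auto simp: norm_mult)
    then show ?thesis using S(2) a(1) norm_zero zero_neq_one unfolding asymmetric_def rot_inv_def by metis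
  qed
  moreover have False if b: "cmod b = 1" "\<And>z. toggle c S (b * cnj z) = toggle c S z" for b
  proof -
    have "toggle k S (b * \<rho>\<^sup>2 / z) = toggle k S z" for z
    proof (cases "cmod z = \<rho>")
      case True
      then have "z \<noteq> 0" using \<rho> by auto
      have "z * cnj z = complex_of_real (\<rho>\<^sup>2)" using complex_norm_square[of z] True by simp
      then have "b * \<rho>\<^sup>2 / z = b * cnj z" using \<open>z \<noteq> 0\<close> by (simp add: field_simps)
      moreover have "cmod (b * cnj z) = \<rho>" using True b by (simp add: norm_mult)
      ultimately show ?thesis using on[of z] on[of "b * cnj z"] True b(2) by simp
    next
      case False
      have "cmod (b * \<rho>\<^sup>2 / z) = \<rho>\<^sup>2 / cmod z" using b by (simp add: norm_mult norm_divide norm_power)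
      also have "\<dots> \<noteq> \<rho>" using False \<rho> by (cases "z = 0") (auto simp: divide_eq_eq power2_eq_square)
      finally show ?thesis using off[of z] off[of "b * \<rho>\<^sup>2 / z"] False by simp
    qed
    moreover have "b * \<rho>\<^sup>2 \<noteq> 0" using b \<rho> by auto
    ultimately show False using S(2) unfolding asymmetric_def refl_inv_def by blast
  qed
  ultimately have "plane_asymmetric (toggle c S)" unfolding plane_asymmetric_def by blast
  then show ?thesis using S by blast
qed

section \<open>Points on two different circles\<close>

definition rot_free_on :: "real \<Rightarrow> (complex \<Rightarrow> bool) \<Rightarrow> bool" where
  "rot_free_on \<rho> c \<longleftrightarrow> (\<forall>a. cmod a = 1 \<longrightarrow> (\<forall>z. cmod z = \<rho> \<longrightarrow> c (a * z) = c z) \<longrightarrow> a = 1)"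

lemma rot_free_on_cong:
  assumes "\<And>z. cmod z = \<rho> \<Longrightarrow> c z = k z"
  shows "rot_free_on \<rho> c = rot_free_on \<rho> k"
  using assms unfolding rot_free_on_def by (simp add: norm_mult)

text \<open>If \<open>a\<close> preserved \<open>c\<close> and \<open>b\<close> preserved the
  toggled colouring, reaching \<open>a * b * w\<close> in both orders would give different colours
  unless this point is \<open>w\<close>, and that case is contradictory as well.\<close>

lemma rot_free_on_toggle:
  assumes w: "w \<noteq> 0"
  shows "rot_free_on (cmod w) c \<or> rot_free_on (cmod w) (toggle c {w})"
proof (rule ccontr)
  assume "\<not> ?thesis"
  then obtain a b where a: "cmod a = 1" "a \<noteq> 1" "\<And>z. cmod z = cmod w \<Longrightarrow> c (a * z) = c z"
    and b: "cmod b = 1" "b \<noteq> 1" "\<And>z. cmod z = cmod w \<Longrightarrow> toggle c {w} (b * z) = toggle c {w} z"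
    unfolding rot_free_on_def by blast
  have n: "a * w \<noteq> w" "b * w \<noteq> w" "a \<noteq> 0" using a b w by auto
  have cb: "c (b * w) \<noteq> c w" using b(3)[of w] n by (auto simp: toggle_def)
  have "c (a * (b * w)) = c (b * w)" using a(3)[of "b * w"] b(1) by (simp add: norm_mult)
  moreover have "toggle c {w} (b * (a * w)) = c w"
    using b(3)[of "a * w"] a(1) a(3)[of w] n by (simp add: norm_mult toggle_def)
  ultimately have ab: "a * (b * w) = w" using cb by (auto simp: toggle_def mult.left_commute)
  have "c (a * (b * w)) = c (b * w)" using a(3)[of "b * w"] b(1) by (simp add: norm_mult)
  then show False using ab cb by simp
qed

text \<open>The circle of radius \<open>\<rho>\<close> is unaffected by the toggle, so a new
  reflection composed with \<open>b\<close> would be a rotation of it and hence trivial. Thus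
  \<open>b\<close> is the only candidate, and it fails at \<open>y\<close>.\<close>

lemma toggle_plane_asymmetric:
  assumes c: "rot_free_on \<rho> c" and b: "cmod b = 1" "\<And>z. c (b * cnj z) = c z"
    and y: "b * cnj y \<noteq> y" "cmod y \<noteq> \<rho>"
  shows "plane_asymmetric (toggle c {y})"
proof -
  have t: "toggle c {y} z = c z" if "cmod z = \<rho>" for z using y that by (auto simp: toggle_def)
  have "rot_free_on \<rho> (toggle c {y})" using c rot_free_on_cong[OF t] by simp
  then have "a = 1" if "cmod a = 1" "\<And>z. toggle c {y} (a * z) = toggle c {y} z" for a
    using that unfolding rot_free_on_def by blast
  moreover have False if b': "cmod b' = 1" "\<And>z. toggle c {y} (b' * cnj z) = toggle c {y} z" for b'
  proof -
    have "c (b' * cnj b * z) = c z" if "cmod z = \<rho>" for z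
    proof -
      have m: "cmod (b * cnj z) = \<rho>" "cmod (b' * cnj (b * cnj z)) = \<rho>"
        using that b b' by (simp_all add: norm_mult)
      have "c (b' * cnj (b * cnj z)) = c (b * cnj z)"
        using b'(2)[of "b * cnj z"] unfolding t[OF m(1)] t[OF m(2)] .
      then show ?thesis using b(2)[of z] by (simp add: mult.assoc)
    qed
    moreover have "cmod (b' * cnj b) = 1" using b b' by (simp add: norm_mult)
    ultimately have "b' * cnj b = 1" using c unfolding rot_free_on_def by blast
    moreover have "b * cnj b = 1" using complex_norm_square[of b] b(1) by simp
    ultimately have "b' = b" by (metis mult.commute mult.assoc mult.right_neutral)
    then show False using b'(2)[of y] b(2)[of y] y(1) by (auto simp: toggle_def)
  qed
  ultimately show ?thesis unfolding plane_asymmetric_def by blast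
qed

text \<open>Both circles can be freed of rotations by toggling at most one point on each. A
  remaining reflection moves \<open>w\<close> or \<open>w'\<close>, since they are not parallel, and
  toggling the moved point destroys it.\<close>

lemma two_circles_asymmetric:
  assumes par: "Im (w' * cnj w) \<noteq> 0" and r: "cmod w \<noteq> cmod w'"
  shows "\<exists>S\<subseteq>{w, w'}. plane_asymmetric (toggle c S)"
proof -
  have n: "w \<noteq> 0" "w' \<noteq> 0" "w \<noteq> w'" using par r by auto
  obtain A where A: "A \<subseteq> {w}" "rot_free_on (cmod w) (toggle c A)"
    using rot_free_on_toggle[OF n(1), of c] by (metis empty_subsetI subset_refl toggle_empty)
  obtain B where B: "B \<subseteq> {w'}" "rot_free_on (cmod w') (toggle (toggle c A) B)"
    using rot_free_on_toggle[OF n(2), of "toggle c A"] by (metis empty_subsetI subset_refl toggle_empty)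
  define k where "k = toggle (toggle c A) B"
  have k2: "rot_free_on (cmod w') k" using B by (simp add: k_def)
  have "k z = toggle c A z" if "cmod z = cmod w" for z
    using that B r by (auto simp: k_def toggle_def)
  then have k1: "rot_free_on (cmod w) k" using A(2) rot_free_on_cong[of "cmod w" k] by metis
  have sub: "\<exists>S\<subseteq>{w, w'}. plane_asymmetric (toggle c S)"
    if "C \<subseteq> {w, w'}" "plane_asymmetric (toggle k C)" for C
  proof -
    have "toggle k C = toggle c ((((A - B) \<union> (B - A)) - C) \<union> (C - ((A - B) \<union> (B - A))))"
      unfolding k_def toggle_toggle ..
    moreover have "(((A - B) \<union> (B - A)) - C) \<union> (C - ((A - B) \<union> (B - A))) \<subseteq> {w, w'}"
      using A B that by auto
    ultimately show ?thesis using that by metis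
  qed
  show ?thesis
  proof (cases "plane_asymmetric k")
    case True
    then show ?thesis using sub[of "{}"] by simp
  next
    case False
    have "a = 1" if "cmod a = 1" "\<And>z. k (a * z) = k z" for a
      using k1 that unfolding rot_free_on_def by blast
    then obtain b where b: "cmod b = 1" "\<And>z. k (b * cnj z) = k z"
      using False unfolding plane_asymmetric_def by blast
    have "\<not> (b * cnj w = w \<and> b * cnj w' = w')"
    proof
      assume e: "b * cnj w = w \<and> b * cnj w' = w'"
      then have "w' * cnj w = cnj (w' * cnj w)" 
        by (metis complex_cnj_cnj complex_cnj_mult mult.commute mult.left_commute)
      then have "Im (w' * cnj w) = - Im (w' * cnj w)" by (metis cnj.sel(2))
      then show False using par by simp
    qed
    then consider "b * cnj w \<noteq> w" | "b * cnj w' \<noteq> w'" by blast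
    then show ?thesis
    proof cases
      case 1
      then show ?thesis using toggle_plane_asymmetric[OF k2 b _ r] sub[of "{w}"] by blast
    next
      case 2
      then show ?thesis using toggle_plane_asymmetric[OF k1 b, of w'] r sub[of "{w'}"] by auto
    qed
  qed
qed

lemma plane_seven_points_asymmetric:
  assumes W: "card_at_least W 7" and pq: "p \<in> W" "q \<in> W" "Im (q * cnj p) \<noteq> 0"
  shows "\<exists>S\<subseteq>W. plane_asymmetric (toggle c S)"
proof (cases "\<exists>w\<in>W. \<exists>w'\<in>W. Im (w' * cnj w) \<noteq> 0 \<and> cmod w \<noteq> cmod w'")
  case True
  then obtain w w' where w: "w \<in> W" "w' \<in> W" "Im (w' * cnj w) \<noteq> 0" "cmod w \<noteq> cmod w'" by blast
  obtain S where "S \<subseteq> {w, w'}" "plane_asymmetric (toggle c S)"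
    using two_circles_asymmetric[OF w(3,4)] by blast
  then show ?thesis using w by blast
next
  case False
  have eq: "cmod w = cmod w'" if "w \<in> W" "w' \<in> W" "Im (w' * cnj w) \<noteq> 0" for w w'
    using False that by blast
  have p0: "p \<noteq> 0" using pq by auto
  \<comment> \<open>A nonzero point cannot be parallel to both \<open>p\<close> and
    \<open>q\<close>, so it shares the radius of one of them, and these two radii agree.\<close>
  have circ: "cmod z = cmod p" if z: "z \<in> W" "z \<noteq> 0" for z
  proof (cases "Im (z * cnj p) = 0 \<and> Im (z * cnj q) = 0")
    case True
    have "(Re z * Re z + Im z * Im z) * Im (q * cnj p) =
      (Re z * Re q + Im z * Im q) * Im (z * cnj p) - (Re z * Re p + Im z * Im p) * Im (z * cnj q)"
      by (simp add: algebra_simps)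
    then have "Re z * Re z + Im z * Im z = 0" using True pq(3) by simp
    then show ?thesis using z by (simp add: complex_eq_iff sum_squares_eq_zero_iff)
  next
    case False
    then show ?thesis using eq[OF pq(1) z(1)] eq[OF pq(2) z(1)] eq[OF pq(1,2) pq(3)] by auto
  qed
  \<comment> \<open>The origin may be one of the seven points; six remain on the circle.\<close>
  have "card_at_least (W - {0}) 6"
    using W by (cases "finite W") (auto simp: card_at_least_def card_Diff_singleton_if)
  then obtain T where T: "T \<subseteq> W - {0}" "card T = 6"
    unfolding card_at_least_def using infinite_arbitrarily_large obtain_subset_with_card_n by metis
  have "\<exists>S\<subseteq>T. plane_asymmetric (toggle c S)"
    by (rule one_circle_asymmetric[OF T(2), of "cmod p"]) (use T circ p0 in auto)
  then show ?thesis using T by blast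
qed

section \<open>Orthogonal transformations of the plane in complex form\<close>

definition to_vec :: "complex \<Rightarrow> real^2" where
  "to_vec z = vector [Re z, Im z]"

definition of_vec :: "real^2 \<Rightarrow> complex" where
  "of_vec v = Complex (v $ 1) (v $ 2)"

lemma of_to_vec [simp]: "of_vec (to_vec z) = z"
  by (simp add: of_vec_def to_vec_def)

lemma to_of_vec [simp]: "to_vec (of_vec v) = v"
  by (simp add: of_vec_def to_vec_def vec_eq_iff forall_2)

lemma linear_to_vec: "linear to_vec"
  by (rule linearI) (auto simp: to_vec_def vec_eq_iff forall_2)

lemma linear_of_vec: "linear of_vec"
  by (rule linearI) (auto simp: of_vec_def complex_eq_iff)

lemma inner_of_vec: "of_vec v \<bullet> of_vec w = v \<bullet> w"
  by (simp add: of_vec_def inner_complex_def inner_vec_def sum_2)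

lemma orthonormal_complex:
  assumes "p \<bullet> p = 1" "q \<bullet> q = 1" "p \<bullet> q = 0"
  shows "q = \<i> * p \<or> q = - (\<i> * p)"
proof -
  obtain p1 p2 q1 q2 where pq: "p = Complex p1 p2" "q = Complex q1 q2" by (metis complex.exhaust)
  have e: "p1 * p1 + p2 * p2 = 1" "q1 * q1 + q2 * q2 = 1" "p1 * q1 + p2 * q2 = 0"
    using assms by (auto simp: pq inner_complex_def)
  \<comment> \<open>Lagrange's identity shows that the determinant of an orthonormal pair is
    \<open>1\<close> or \<open>-1\<close>.\<close>
  have "(p1 * q2 - p2 * q1)\<^sup>2 + (p1 * q1 + p2 * q2)\<^sup>2 = (p1 * p1 + p2 * p2) * (q1 * q1 + q2 * q2)"
    by algebra
  then have "(p1 * q2 - p2 * q1)\<^sup>2 = 1" using e by simp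
  then have "p1 * q2 - p2 * q1 = 1 \<or> p1 * q2 - p2 * q1 = -1" by (simp add: power2_eq_1_iff)
  then show ?thesis
  proof
    assume "p1 * q2 - p2 * q1 = 1"
    then have "(q1 + p2)\<^sup>2 + (q2 - p1)\<^sup>2 = 0" using e by algebra
    then show ?thesis by (simp add: pq complex_eq_iff sum_power2_eq_zero_iff)
  next
    assume "p1 * q2 - p2 * q1 = -1"
    then have "(q1 - p2)\<^sup>2 + (q2 + p1)\<^sup>2 = 0" using e by algebra
    then show ?thesis by (simp add: pq complex_eq_iff sum_power2_eq_zero_iff)
  qed
qed

text \<open>The map is determined by the images of \<open>1\<close> and \<open>\<i>\<close>, which
  are orthonormal; the two possible orientations give the two forms.\<close>

lemma O2_complex:
  assumes "f \<in> O2"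
  obtains a where "cmod a = 1"
    "(\<forall>z. of_vec (f (to_vec z)) = a * z) \<or> (\<forall>z. of_vec (f (to_vec z)) = a * cnj z)"
proof -
  define F where "F z = of_vec (f (to_vec z))" for z
  have f: "linear f" "\<And>v w. f v \<bullet> f w = v \<bullet> w"
    using assms by (auto simp: O2_def orthogonal_transformation_def)
  have "linear F"
    unfolding F_def using linear_compose[OF linear_compose[OF linear_to_vec f(1)] linear_of_vec]
    by (simp add: o_def)
  have inner: "F y \<bullet> F z = y \<bullet> z" for y z
    using inner_of_vec[of "to_vec y" "to_vec z"] by (simp add: F_def inner_of_vec f)
  have F: "F z = Re z *\<^sub>R F 1 + Im z *\<^sub>R F \<i>" for z
  proof -
    have "z = Re z *\<^sub>R 1 + Im z *\<^sub>R \<i>" by (simp add: complex_eq_iff)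
    then have "F z = F (Re z *\<^sub>R 1 + Im z *\<^sub>R \<i>)" by simp
    then show ?thesis using \<open>linear F\<close> by (simp add: linear_add linear_scale)
  qed
  have *: "F 1 \<bullet> F 1 = 1" "F \<i> \<bullet> F \<i> = 1" "F 1 \<bullet> F \<i> = 0"
    unfolding inner by (auto simp: inner_complex_def)
  have "cmod (F 1) = 1" using *(1) by (simp add: norm_eq_sqrt_inner)
  moreover from orthonormal_complex[OF *]
  have "(\<forall>z. F z = F 1 * z) \<or> (\<forall>z. F z = F 1 * cnj z)"
  proof
    assume i: "F \<i> = \<i> * F 1"
    have "F z = F 1 * z" for z
      unfolding F[of z] i by (simp add: complex_eq_iff algebra_simps)
    then show ?thesis by blast
  next
    assume i: "F \<i> = - (\<i> * F 1)"
    have "F z = F 1 * cnj z" for z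
      unfolding F[of z] i by (simp add: complex_eq_iff algebra_simps)
    then show ?thesis by blast
  qed
  ultimately show ?thesis using that unfolding F_def by blast
qed

lemma reflection_in_O2:
  assumes "cmod b = 1"
  shows "(\<lambda>v. to_vec (b * cnj (of_vec v))) \<in> O2"
proof -
  have "linear (\<lambda>z. b * cnj z)"
    by (rule linearI) (auto simp: algebra_simps)
  then have "linear (\<lambda>v. to_vec (b * cnj (of_vec v)))"
    using linear_compose[OF linear_compose[OF linear_of_vec] linear_to_vec, of "\<lambda>z. b * cnj z"]
    by (simp add: o_def)
  moreover have "norm (to_vec (b * cnj (of_vec v))) = norm v" for v
  proof -
    have n: "norm v = cmod (of_vec v)" for v :: "real^2"
      by (simp add: norm_eq_sqrt_inner inner_of_vec)
    show ?thesis unfolding n using assms by (simp add: norm_mult)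
  qed
  ultimately show ?thesis by (simp add: O2_def orthogonal_transformation)
qed

lemma reflection_nontrivial: "\<exists>z. b * cnj z \<noteq> z"
proof (rule ccontr)
  assume "\<not> ?thesis"
  then have "b * cnj 1 = 1" "b * cnj \<i> = \<i>" by blast+
  then show False by (auto simp: complex_eq_iff)
qed

text \<open>Points on one line through the origin are all fixed by the reflection in that line,
  whose coefficient is \<open>p / cnj p\<close> for any nonzero \<open>p\<close> on it.\<close>

lemma trivial_stabilizer_nonparallel:
  assumes "trivial_pointwise_stabilizer UNIV O2 W"
  shows "\<exists>p\<in>of_vec ` W. \<exists>q\<in>of_vec ` W. Im (q * cnj p) \<noteq> 0"
proof (rule ccontr)
  assume "\<not> ?thesis"
  then have par: "Im (q * cnj p) = 0" if "p \<in> of_vec ` W" "q \<in> of_vec ` W" for p q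
    using that by blast
  obtain b where b: "cmod b = 1" "\<And>z. z \<in> of_vec ` W \<Longrightarrow> b * cnj z = z"
  proof (cases "of_vec ` W \<subseteq> {0}")
    case True
    then have "1 * cnj z = z" if "z \<in> of_vec ` W" for z using that by force
    then show ?thesis by (rule that[of 1, rotated]) auto
  next
    case False
    then obtain p where p: "p \<in> of_vec ` W" "p \<noteq> 0" by auto
    have "p / cnj p * cnj z = z" if "z \<in> of_vec ` W" for z
    proof -
      have "z * cnj p = cnj (z * cnj p)" using par[OF p(1) that] by (simp add: complex_eq_iff)
      then have "z * cnj p = cnj z * p" by simp
      then show ?thesis using p(2) by (simp add: field_simps)
    qed
    then show ?thesis using that[of "p / cnj p"] p by (simp add: norm_divide)
  qed
  define g where "g = (\<lambda>v. to_vec (b * cnj (of_vec v)))"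
  have "g \<in> O2" unfolding g_def by (rule reflection_in_O2[OF b(1)])
  moreover have "\<forall>w\<in>W. g w = w" using b(2) by (simp add: g_def)
  ultimately have "\<forall>v. g v = v" using assms by (auto simp: trivial_pointwise_stabilizer_def)
  then have "g (to_vec z) = to_vec z" for z by blast
  then have "of_vec (g (to_vec z)) = z" for z by simp
  then have "b * cnj z = z" for z by (simp add: g_def)
  then show False using reflection_nontrivial by blast
qed

lemma ext_good_7: "ext_good UNIV O2 7"
  unfolding ext_good_def
proof (intro allI impI, elim conjE)
  fix W :: "(real^2) set"
  assume card: "card_at_least W 7" and triv: "trivial_pointwise_stabilizer UNIV O2 W"
  have inj: "inj of_vec" by (metis injI to_of_vec)
  have card': "card_at_least (of_vec ` W) 7"
    using card inj_on_subset[OF inj, of W] by (auto simp: card_at_least_def card_image finite_image_iff)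
  obtain p q where pq: "p \<in> of_vec ` W" "q \<in> of_vec ` W" "Im (q * cnj p) \<noteq> 0"
    using trivial_stabilizer_nonparallel[OF triv] by blast
  show "prop_P UNIV O2 W"
    unfolding prop_P_def
  proof
    fix c :: "real^2 \<Rightarrow> bool"
    obtain S where S: "S \<subseteq> of_vec ` W" "plane_asymmetric (toggle (\<lambda>z. c (to_vec z)) S)"
      using plane_seven_points_asymmetric[OF card' pq] by blast
    define k where "k = toggle (\<lambda>z. c (to_vec z)) S"
    have "k (of_vec v) = c v" if "v \<notin> W" for v
    proof -
      have "of_vec v \<notin> S" using that S(1) inj by (auto dest: injD)
      then show ?thesis by (simp add: k_def toggle_def)
    qed
    moreover have "distinguishing UNIV O2 (\<lambda>v. k (of_vec v))"
      unfolding distinguishing_def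
    proof (intro ballI impI)
      fix g and x :: "real^2"
      assume g: "g \<in> O2" "\<forall>x\<in>UNIV. k (of_vec (g x)) = k (of_vec x)"
      have kg: "k (of_vec (g (to_vec z))) = k z" for z using g(2) by simp
      obtain a where a: "cmod a = 1"
        "(\<forall>z. of_vec (g (to_vec z)) = a * z) \<or> (\<forall>z. of_vec (g (to_vec z)) = a * cnj z)"
        using O2_complex[OF g(1)] by blast
      from a(2) show "g x = x"
      proof
        assume r: "\<forall>z. of_vec (g (to_vec z)) = a * z"
        then have "a = 1" using kg S(2) a(1) unfolding plane_asymmetric_def k_def by metis
        then have "of_vec (g x) = of_vec x" using r[rule_format, of "of_vec x"] by simp
        then show ?thesis using inj by (auto dest: injD)
      next
        assume "\<forall>z. of_vec (g (to_vec z)) = a * cnj z"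
        then show ?thesis using kg S(2) a(1) unfolding plane_asymmetric_def k_def by metis
      qed
    qed
    ultimately show "\<exists>c'. (\<forall>x\<in>UNIV - W. c' x = c x) \<and> distinguishing UNIV O2 c'"
      by (intro exI[of _ "\<lambda>v. k (of_vec v)"]) auto
  qed
qed

section \<open>The pentagon and the lower bound\<close>

definition zeta5 :: complex where
  "zeta5 = cis (2 * pi / 5)"

lemma zeta5_power5: "zeta5 ^ 5 = 1"
  unfolding zeta5_def Complex.DeMoivre by simp

lemma cmod_zeta5: "cmod zeta5 = 1"
  by (simp add: zeta5_def)

lemma zeta5_mod: "zeta5 ^ (n mod 5) = zeta5 ^ n"
proof -
  have "zeta5 ^ n = zeta5 ^ (5 * (n div 5) + n mod 5)" by simp
  also have "\<dots> = zeta5 ^ (n mod 5)" by (simp only: power_add power_mult zeta5_power5) simp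
  finally show ?thesis ..
qed

lemma cnj_zeta5_power:
  assumes "i \<le> 5" shows "cnj (zeta5 ^ i) = zeta5 ^ (5 - i)"
proof -
  have "zeta5 ^ i * zeta5 ^ (5 - i) = 1" using assms zeta5_power5 by (simp flip: power_add)
  moreover have "zeta5 ^ i * cnj (zeta5 ^ i) = 1"
    using complex_norm_square[of "zeta5 ^ i"] cmod_zeta5 by (simp add: norm_power)
  moreover have "zeta5 ^ i \<noteq> 0" using cmod_zeta5 by auto
  ultimately show ?thesis by (metis mult_left_cancel)
qed

lemma Im_zeta5: "Im zeta5 > 0"
  by (auto simp: zeta5_def intro!: sin_gt_zero)

lemma inj_zeta5: "inj_on (\<lambda>i. zeta5 ^ i) {..<5}"
proof -
  have "zeta5 ^ i = cis (2 * pi * real i / real 5)" for i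
    unfolding zeta5_def Complex.DeMoivre by (simp add: mult.commute)
  then show ?thesis using bij_betw_imp_inj_on[OF Complex.bij_betw_roots_unity[of 5]] by simp
qed

text \<open>The indices describe the reflection \<open>i\<close> to \<open>j - i\<close> modulo
  five, written with \<open>5 - i\<close> to stay within the natural numbers. The 32 colourings are
  checked one by one.\<close>

lemma pentagon_reflection:
  fixes f :: "nat \<Rightarrow> bool"
  shows "\<exists>j<5. \<forall>i<5. f ((j + (5 - i)) mod 5) = f i"
proof -
  have all: "(\<forall>i<5. P i) \<longleftrightarrow> P 0 \<and> P 1 \<and> P 2 \<and> P 3 \<and> P (4::nat)" for P
    by (auto simp: numeral_eq_Suc less_Suc_eq)
  have ex: "(\<exists>i<5. P i) \<longleftrightarrow> P 0 \<or> P 1 \<or> P 2 \<or> P 3 \<or> P (4::nat)" for P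
    by (auto simp: numeral_eq_Suc less_Suc_eq)
  show ?thesis unfolding all ex
    by (cases "f 0"; cases "f 1"; cases "f 2"; cases "f 3"; cases "f 4") (simp_all add: numeral_2_eq_2)
qed

definition pentagon :: "complex set" where
  "pentagon = (\<lambda>i. zeta5 ^ i) ` {..<5}"

text \<open>A single set of six points, the pentagon with its centre, refutes every \<open>m\<close>
  up to six. With a constant precolouring outside, a reflection preserving the colours of the
  vertices preserves the whole colouring.\<close>

lemma not_ext_good:
  assumes "m \<le> 6"
  shows "\<not> ext_good UNIV O2 m"
proof
  assume good: "ext_good UNIV O2 m"
  define W where "W = to_vec ` insert 0 pentagon"
  have inj: "inj to_vec" by (metis injI of_to_vec)
  have "0 \<notin> pentagon" using cmod_zeta5 by (auto simp: pentagon_def)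
  moreover have "card pentagon = 5" unfolding pentagon_def by (simp add: card_image[OF inj_zeta5])
  moreover have "finite pentagon" by (simp add: pentagon_def)
  ultimately have "card (insert 0 pentagon) = 6" by simp
  then have "card W = 6"
    unfolding W_def using card_image[OF inj_on_subset[OF inj subset_UNIV], of "insert 0 pentagon"] by simp
  then have "card_at_least W m" using assms by (simp add: card_at_least_def)
  moreover have "trivial_pointwise_stabilizer UNIV O2 W"
    unfolding trivial_pointwise_stabilizer_def
  proof (intro ballI impI)
    fix g and v :: "real^2" assume g: "g \<in> O2" "\<forall>w\<in>W. g w = w"
    obtain a where a:
      "(\<forall>z. of_vec (g (to_vec z)) = a * z) \<or> (\<forall>z. of_vec (g (to_vec z)) = a * cnj z)"
      using O2_complex[OF g(1)] by blast
    have fix': "of_vec (g (to_vec (zeta5 ^ i))) = zeta5 ^ i" if "i < 5" for i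
      using g(2) that by (simp add: W_def pentagon_def)
    have f0: "of_vec (g (to_vec 1)) = 1" and f1: "of_vec (g (to_vec zeta5)) = zeta5"
      using fix'[of 0] fix'[of 1] by simp_all
    from a show "g v = v"
    proof
      assume r: "\<forall>z. of_vec (g (to_vec z)) = a * z"
      then have "a = 1" using f0 by simp
      then have "of_vec (g v) = of_vec v" using r[rule_format, of "of_vec v"] by simp
      then show ?thesis by (metis to_of_vec)
    next
      assume r: "\<forall>z. of_vec (g (to_vec z)) = a * cnj z"
      then have "a = 1" using f0 by simp
      then have "cnj zeta5 = zeta5" using r f1 by simp
      then have "Im zeta5 = 0" by (metis cnj.sel(2) neg_equal_zero)
      then show ?thesis using Im_zeta5 by simp
    qed
  qed
  ultimately have "prop_P UNIV O2 W" using good by (simp add: ext_good_def)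
  then obtain c where c: "\<forall>x\<in>UNIV - W. c x = False" "distinguishing UNIV O2 c"
    unfolding prop_P_def by meson
  obtain j where j: "\<And>i. i < 5 \<Longrightarrow> c (to_vec (zeta5 ^ ((j + (5 - i)) mod 5))) = c (to_vec (zeta5 ^ i))"
    using pentagon_reflection[of "\<lambda>i. c (to_vec (zeta5 ^ i))"] by blast
  define b where "b = zeta5 ^ j"
  have b: "cmod b = 1" by (simp add: b_def norm_power cmod_zeta5)
  have bz: "b * cnj (zeta5 ^ i) = zeta5 ^ ((j + (5 - i)) mod 5)" if "i < 5" for i
    using that by (simp only: b_def zeta5_mod cnj_zeta5_power power_add less_imp_le)
  have pent: "b * cnj z \<in> pentagon" if "z \<in> pentagon" for z
    using that bz by (auto simp: pentagon_def)
  have invol: "b * cnj (b * cnj z) = z" for z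
    using complex_norm_square[of b] b by (simp add: mult.assoc[symmetric])
  have cb: "c (to_vec (b * cnj z)) = c (to_vec z)" for z
  proof (cases "z \<in> insert 0 pentagon")
    case True
    then show ?thesis using j bz by (auto simp: pentagon_def)
  next
    case False
    then have "b * cnj z \<notin> insert 0 pentagon"
      using pent[of "b * cnj z", unfolded invol] b by auto
    then have "to_vec (b * cnj z) \<notin> W" "to_vec z \<notin> W"
      unfolding W_def using False inj by (auto dest: injD)
    then show ?thesis using c(1) by simp
  qed
  have "(\<lambda>v. to_vec (b * cnj (of_vec v))) \<in> O2" by (rule reflection_in_O2[OF b])
  moreover have "c (to_vec (b * cnj (of_vec v))) = c v" for v using cb[of "of_vec v"] by simp
  ultimately have "to_vec (b * cnj (of_vec v)) = v" for v
    using c(2) by (auto simp: distinguishing_def)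
  then have "of_vec (to_vec (b * cnj (of_vec (to_vec z)))) = of_vec (to_vec z)" for z by metis
  then show False using reflection_nontrivial[of b] by simp
qed

theorem theorem3p1:
  shows "ext_D (UNIV :: (real^2) set) O2 = 7"
proof -
  have "(LEAST m. ext_good (UNIV :: (real^2) set) O2 m) = 7"
  proof (rule Least_equality)
    show "ext_good (UNIV :: (real^2) set) O2 7" by (rule ext_good_7)
    show "7 \<le> m" if "ext_good (UNIV :: (real^2) set) O2 m" for m
      using that not_ext_good[of m] by (metis Suc_leI not_less_eq_eq eval_nat_numeral(3) not_le)
  qed
  then show ?thesis using ext_good_7 unfolding ext_D_def by (auto simp: numeral_eq_enat)
qed

end
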